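(* Let $\xi$ and $\eta$ be Killing fields on $\mathbb{R}^{n,1}$ with $\xi\neq 0$ and $[\xi^\sharp,\eta^\sharp]=\xi^\sharp$. Then, by a Poincaré transformation, they can be brought simultaneously into one of the following two forms, with some integer $r\ge 0$ and real constants $b_j$ and $q$ (sums with $r=0$ being empty): either $$\xi=(x^0-x^2)dx^1-x^1(dx^0-dx^2),$$ $$\eta=x^0dx^2-x^2dx^0+\sum_{i=1}^r b_{2i+1}\left(x^{2i+1}dx^{2i+2}-x^{2i+2}dx^{2i+1}\right)+q\,dx^n,$$ or $$\xi=-dx^0+dx^1,$$ $$\eta=x^0dx^1-x^1dx^0+\sum_{i=1}^r b_{2i}\left(x^{2i}dx^{2i+1}-x^{2i+1}dx^{2i}\right)+q\,dx^n.$$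
   Context: $\mathbb{R}^{n,1}$ ($n\ge1$) is the $(n+1)$-dimensional Minkowski spacetime with inertial coordinates $(x^0,\dots,x^n)$ and metric $-(dx^0)^2+\sum_{i=1}^n(dx^i)^2$ (here $\eta$ denotes a Killing field, not the metric). Killing fields are written as 1-forms $\xi=\xi_\nu dx^\nu$ with $\partial_\mu\xi_\nu+\partial_\nu\xi_\mu=0$; $\xi^\sharp=\xi^\mu\partial_\mu$ is the metric dual vector field, and $[\cdot,\cdot]$ is the Lie bracket of vector fields. A Poincaré transformation is a change of inertial coordinates $x'^\mu=\Lambda^\mu{}_\nu x^\nu+c^\mu$ with $\Lambda\in O_{n,1}$ (full Lorentz group) and $c\in\mathbb{R}^{n+1}$; the same transformation is applied to both fields. The first form presupposes $n\ge 2$; in each form all coordinate indices occurring in the sum are at most $n$. *)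

theory Defs
  imports "HOL-Analysis.Analysis"
begin

text \<open>
  Points, vectors and covectors of \<open>(n+1)\<close>-dimensional Minkowski spacetime are elements of
  \<open>real ^ 'm\<close>, where \<open>'m\<close> has \<open>n + 1\<close> elements. The numbering of the inertial coordinates
  \<open>x\<^sup>0, \<dots>, x\<^sup>n\<close> is a map \<open>e :: nat \<Rightarrow> 'm\<close> which is a bijection from \<open>{0..n}\<close> onto \<open>'m\<close>;
  \<open>e 0\<close> is the time index. A vector field, or a 1-form \<open>\<xi>\<^sub>\<nu> dx\<^sup>\<nu>\<close>, is the function
  \<open>real ^ 'm \<Rightarrow> real ^ 'm\<close> of its components.
\<close>

definition minkowski_metric :: "(nat \<Rightarrow> 'm::finite) \<Rightarrow> real ^ 'm ^ 'm" where
  "minkowski_metric e = (\<chi> \<mu> \<nu>. if \<mu> = \<nu> then (if \<mu> = e 0 then - 1 else 1) else 0)"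

definition lorentz_group :: "(nat \<Rightarrow> 'm::finite) \<Rightarrow> (real ^ 'm ^ 'm) set" where
  "lorentz_group e =
     {\<Lambda>. transpose \<Lambda> ** minkowski_metric e ** \<Lambda> = minkowski_metric e}"

definition crd :: "(nat \<Rightarrow> 'm::finite) \<Rightarrow> nat \<Rightarrow> real ^ 'm \<Rightarrow> real" where
  "crd e i x = x $ e i"

text \<open>The (constant) component vector of the 1-form \<open>dx\<^sup>i\<close>.\<close>

definition dcrd :: "(nat \<Rightarrow> 'm::finite) \<Rightarrow> nat \<Rightarrow> real ^ 'm" where
  "dcrd e i = axis (e i) 1"

definition partial_deriv :: "'m::finite \<Rightarrow> (real ^ 'm \<Rightarrow> real) \<Rightarrow> real ^ 'm \<Rightarrow> real" where
  "partial_deriv \<mu> f x = frechet_derivative f (at x) (axis \<mu> 1)"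

primrec times_cont_diff ::
  "nat \<Rightarrow> ('a::real_normed_vector \<Rightarrow> 'b::real_normed_vector) \<Rightarrow> bool" where
  "times_cont_diff 0 f \<longleftrightarrow> continuous_on UNIV f"
| "times_cont_diff (Suc k) f \<longleftrightarrow>
     f differentiable_on UNIV \<and>
     (\<forall>v. times_cont_diff k (\<lambda>x. frechet_derivative f (at x) v))"

definition smooth :: "('a::real_normed_vector \<Rightarrow> 'b::real_normed_vector) \<Rightarrow> bool" where
  "smooth f \<longleftrightarrow> (\<forall>k. times_cont_diff k f)"

text \<open>
  Killing fields as 1-forms. In inertial coordinates the metric is constant, so its Christoffel
  symbols vanish and the Killing equation involves partial derivatives only.
\<close>

definition killing_field :: "(real ^ 'm::finite \<Rightarrow> real ^ 'm) \<Rightarrow> bool" where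
  "killing_field \<xi> \<longleftrightarrow> smooth \<xi> \<and>
     (\<forall>x \<mu> \<nu>. partial_deriv \<mu> (\<lambda>y. \<xi> y $ \<nu>) x + partial_deriv \<nu> (\<lambda>y. \<xi> y $ \<mu>) x = 0)"

definition sharp ::
  "(nat \<Rightarrow> 'm::finite) \<Rightarrow> (real ^ 'm \<Rightarrow> real ^ 'm) \<Rightarrow> real ^ 'm \<Rightarrow> real ^ 'm" where
  "sharp e \<xi> x = matrix_inv (minkowski_metric e) *v \<xi> x"

definition lie_bracket ::
  "(real ^ 'm::finite \<Rightarrow> real ^ 'm) \<Rightarrow> (real ^ 'm \<Rightarrow> real ^ 'm) \<Rightarrow> real ^ 'm \<Rightarrow> real ^ 'm" where
  "lie_bracket X Y x =
     (\<chi> \<mu>. \<Sum>\<nu>\<in>UNIV. X x $ \<nu> * partial_deriv \<nu> (\<lambda>y. Y y $ \<mu>) x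
                    - Y x $ \<nu> * partial_deriv \<nu> (\<lambda>y. X y $ \<mu>) x)"

text \<open>
  The components of the 1-form \<open>\<xi>\<close> in the coordinates \<open>x' = \<Lambda> x + c\<close>, as a function of \<open>x'\<close>:
  \<open>\<xi>'\<^sub>\<mu>(x') dx'\<^sup>\<mu> = \<xi>\<^sub>\<nu>(x) dx\<^sup>\<nu>\<close> means \<open>\<xi>'\<^sub>\<mu>(x') = (\<Lambda>\<^sup>-\<^sup>1)\<^sup>\<nu>\<^sub>\<mu> \<xi>\<^sub>\<nu>(\<Lambda>\<^sup>-\<^sup>1 (x' - c))\<close>.
\<close>

definition transform_form ::
  "real ^ 'm ^ 'm \<Rightarrow> real ^ 'm \<Rightarrow> (real ^ 'm::finite \<Rightarrow> real ^ 'm) \<Rightarrow> real ^ 'm \<Rightarrow> real ^ 'm" where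
  "transform_form \<Lambda> c \<xi> x' = transpose (matrix_inv \<Lambda>) *v \<xi> (matrix_inv \<Lambda> *v (x' - c))"

end

theory Submission
  imports Defs
begin

text \<open>
  A Killing field is affine, and raising the index turns \<open>\<xi>\<close>, \<open>\<eta>\<close> into \<open>x \<mapsto> K x + k\<close>, \<open>x \<mapsto> L x + l\<close>
  with \<open>K\<close>, \<open>L\<close> skew for the Minkowski form \<open>g\<close>; the bracket condition becomes \<open>[L, K] = K\<close>
  and \<open>L k - K l = k\<close>. If \<open>K = 0\<close>, then \<open>N = k\<close> is null with \<open>L N = N\<close>. If \<open>K \<noteq> 0\<close>, then \<open>K\<close> is
  nilpotent, and since a totally isotropic subspace has dimension at most 1,
  \<open>K\<^sup>3 = 0\<close> and \<open>K\<^sup>2 = - g(N, \<cdot>) N\<close> with \<open>N\<close> null, and again \<open>L N = N\<close>. In both cases \<open>L\<close> also has a null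
  eigenvector \<open>M\<close> with eigenvalue \<open>- 1\<close>, normalised by \<open>g(N, M) = - 2\<close>. The vectors \<open>(N + M)/2\<close>,
  \<open>(N - M)/2\<close>, and in the second case \<open>K M/2\<close>, begin the Lorentz frame. On their
  orthogonal complement \<open>g\<close> is positive definite, \<open>K\<close> vanishes and \<open>L\<close> splits into plane rotations
  and a kernel; a translation moves \<open>l\<close> into the kernel, where it is made the last frame direction.
\<close>

subsection \<open>Skew maps on definite subspaces\<close>

lemmas bilinear_expand = bilinear_ladd bilinear_radd bilinear_lmul bilinear_rmul
  bilinear_lneg bilinear_rneg bilinear_lsub bilinear_rsub bilinear_lzero bilinear_rzero

lemma subspace_bilinear_orthogonal:
  assumes "bilinear g" "subspace W"
  shows "subspace {x \<in> W. g v x = 0}"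
  using assms(2) by (auto simp: subspace_def bilinear_expand[OF assms(1)])

text \<open>Removing the component \<open>g v x / g v v\<close> along \<open>v\<close> splits
  \<open>W\<close> into the line of \<open>v\<close> and its complement. Since \<open>g v v\<close>
  may be negative, this also serves timelike vectors.\<close>

lemma dim_bilinear_orthogonal:
  fixes g :: "'a::euclidean_space \<Rightarrow> 'a \<Rightarrow> real"
  assumes "bilinear g" "subspace W" "v \<in> W" "g v v \<noteq> 0"
  shows "dim {x \<in> W. g v x = 0} + 1 = dim W"
proof -
  let ?U = "{x \<in> W. g v x = 0}"
  have U: "subspace ?U" by (rule subspace_bilinear_orthogonal[OF assms(1,2)])
  then have "span ?U = ?U" by (rule span_eq_iff[THEN iffD2])
  moreover have "v \<notin> ?U" using assms(4) by simp
  ultimately have v: "v \<notin> span ?U" by (rule ssubst)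
  have "W \<subseteq> span (insert v ?U)"
  proof
    fix x assume x: "x \<in> W"
    let ?c = "g v x / g v v"
    have "x - ?c *\<^sub>R v \<in> ?U"
      using x assms by (auto simp: bilinear_expand[OF assms(1)] intro: subspace_diff subspace_scale)
    then have "x - ?c *\<^sub>R v \<in> span ?U" by (rule span_base)
    then show "x \<in> span (insert v ?U)"
      unfolding span_breakdown_eq by (rule exI)
  qed
  then have "span (insert v ?U) = W"
    using assms(2,3) by (intro equalityI span_minimal) auto
  then have "dim W = dim (insert v ?U)" by (rule subst) (rule dim_span)
  also have "\<dots> = dim ?U + 1" unfolding dim_insert if_not_P[OF v] ..
  finally show ?thesis by (rule sym)
qed

text \<open>A maximum of the Rayleigh quotient of the form \<open>g (L x) (L x)\<close> is an eigenvector of \<open>L\<^sup>2\<close>.\<close>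

lemma skew_square_eigenvector:
  fixes g :: "'a::euclidean_space \<Rightarrow> 'a \<Rightarrow> real"
  assumes g: "bilinear g" and sym: "\<And>x y. g x y = g y x"
    and W: "subspace W" and pos: "\<And>x. x \<in> W \<Longrightarrow> x \<noteq> 0 \<Longrightarrow> g x x > 0"
    and L: "linear L" and LW: "\<And>x. x \<in> W \<Longrightarrow> L x \<in> W"
    and skew: "\<And>x y. x \<in> W \<Longrightarrow> y \<in> W \<Longrightarrow> g (L x) y = - g x (L y)"
    and w: "w \<in> W" "w \<noteq> 0"
  obtains v where "v \<in> W" "v \<noteq> 0" "L (L v) = - (g (L v) (L v) / g v v) *\<^sub>R v"
proof -
  note be = bilinear_expand[OF g] and le = linear_add[OF L] linear_scale[OF L]
  \<comment> \<open>The quotient is homogeneous of degree 0, so its maximum over nonzero vectors of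
    \<open>W\<close> can be sought on the compact Euclidean unit sphere.\<close>
  let ?S = "sphere 0 1 \<inter> W"
  have cont: "continuous_on ?S (\<lambda>x. g (L x) (L x) / g x x)"
  proof -
    have bg: "bounded_bilinear g" using g by (simp add: bilinear_conv_bounded_bilinear)
    have cL: "continuous_on ?S L"
      using L linear_continuous_on linear_conv_bounded_linear by blast
    have "g x x \<noteq> 0" if "x \<in> ?S" for x
      using pos[of x] that by fastforce
    then show ?thesis
      by (intro continuous_on_divide bounded_bilinear.continuous_on[OF bg] cL) (auto intro: continuous_intros)
  qed
  have "compact ?S" by (intro compact_Int_closed compact_sphere closed_subspace W)
  moreover have "(1 / norm w) *\<^sub>R w \<in> ?S" using w W by (auto simp: subspace_scale)
  ultimately obtain v where v: "v \<in> ?S"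
    and max: "\<And>x. x \<in> ?S \<Longrightarrow> g (L x) (L x) / g x x \<le> g (L v) (L v) / g v v"
    using continuous_attains_sup[OF _ _ cont] by blast
  let ?c = "g (L v) (L v) / g v v"
  have vW: "v \<in> W" "v \<noteq> 0" using v by auto
  have le_c: "g (L x) (L x) \<le> ?c * g x x" if x: "x \<in> W" for x
  proof (cases "x = 0")
    case True
    then show ?thesis using linear_0[OF L] by (simp add: be)
  next
    case False
    let ?y = "(1 / norm x) *\<^sub>R x"
    have "?y \<in> ?S" using x False W by (auto simp: subspace_scale)
    from max[OF this] show ?thesis
      using pos[OF x False] False by (simp add: be le field_simps)
  qed
  let ?z = "L (L v) + ?c *\<^sub>R v"
  have zW: "?z \<in> W" using vW W LW by (auto simp: subspace_add subspace_scale)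
  have orth: "g ?z y = 0" if y: "y \<in> W" for y
  proof -
    let ?q = "?c * g y y - g (L y) (L y)" and ?m = "- g ?z y"
    have cv: "g (L v) (L v) = ?c * g v v" using pos[OF vW] by simp
    have m: "?m = g (L v) (L y) - ?c * g v y"
      using skew[of "L v" y] vW y LW by (simp add: be)
    \<comment> \<open>Maximality of \<open>v\<close>, tested at a perturbation in direction
      \<open>y\<close>; the terms of order 0 in \<open>t\<close> cancel. Nonnegativity for all
      \<open>t\<close> forces the linear coefficient to vanish.\<close>
    have q: "?q * t\<^sup>2 - 2 * ?m * t \<ge> 0" for t
    proof -
      have "v + t *\<^sub>R y \<in> W" using vW y W by (auto simp: subspace_add subspace_scale)
      from le_c[OF this] have "g (L v) (L v) + 2 * t * g (L v) (L y) + t^2 * g (L y) (L y)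
           \<le> ?c * g v v + ?c * (2 * t * g v y + t^2 * g y y)"
        using sym[of "L y" "L v"] sym[of y v]
        by (simp add: be le algebra_simps power2_eq_square)
      then show ?thesis unfolding cv[symmetric] m by (simp add: algebra_simps)
    qed
    have "?m = 0"
    proof (rule ccontr)
      assume m0: "?m \<noteq> 0"
      define s where "s = ?m"
      \<comment> \<open>At \<open>t = s / Q\<close> the quadratic term is at most
        \<open>s * (s / Q)\<close>, half of the linear term that it would have to outweigh.\<close>
      define Q where "Q = \<bar>?q\<bar> + 1"
      have Q: "Q > 0" "?q < Q" unfolding Q_def by auto
      have "?q * (s / Q)\<^sup>2 - 2 * s * (s / Q) \<ge> 0" using q[of "s / Q"] unfolding s_def .
      moreover have "?q * (s / Q)\<^sup>2 \<le> Q * (s / Q)\<^sup>2" using Q by (intro mult_right_mono) auto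
      moreover have "Q * (s / Q)\<^sup>2 = s * (s / Q)" using Q by (simp add: power2_eq_square)
      moreover have "s * (s / Q) > 0" using m0 Q(1) unfolding s_def[symmetric]
      by (metis divide_pos_pos not_real_square_gt_zero times_divide_eq_right)
      ultimately show False by linarith
    qed
    then show ?thesis by simp
  qed
  have "?z = 0" using pos[OF zW] orth[OF zW] by force
  then show thesis using that[OF vW] by (simp add: add_eq_0_iff2)
qed

text \<open>The real normal form of a skew map: an orthonormal basis of \<open>W\<close> with
  \<open>r\<close> rotation planes first and kernel vectors last. Values of \<open>u\<close> from
  \<open>dim W\<close> on are free, so frames can be extended by \<open>case_nat\<close> or by
  function update.\<close>

definition skew_frame ::
  "('a::euclidean_space \<Rightarrow> 'a \<Rightarrow> real) \<Rightarrow> ('a \<Rightarrow> 'a) \<Rightarrow> 'a set \<Rightarrow> (nat \<Rightarrow> 'a) \<Rightarrow> nat \<Rightarrow> (nat \<Rightarrow> real) \<Rightarrow> bool"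
  where "skew_frame g L W u r b \<longleftrightarrow> 2 * r \<le> dim W \<and> (\<forall>i<dim W. u i \<in> W) \<and>
    (\<forall>i<dim W. \<forall>j<dim W. g (u i) (u j) = (if i = j then 1 else 0)) \<and>
    (\<forall>i<r. L (u (2*i)) = b i *\<^sub>R u (2*i+1) \<and> L (u (2*i+1)) = - b i *\<^sub>R u (2*i)) \<and>
    (\<forall>i<dim W. 2 * r \<le> i \<longrightarrow> L (u i) = 0)"

text \<open>The kernel vector goes to the last index \<open>dim W - 1\<close>, which leaves the
  pairing of the earlier indices intact and later becomes the direction of \<open>q\<close>.\<close>

lemma skew_frame_append:
  assumes g: "bilinear g" and sym: "\<And>x y. g x y = g y x" and W: "subspace W"
    and v: "v \<in> W" "g v v = 1" "L v = 0"
    and u: "skew_frame g L {x \<in> W. g v x = 0} u r b"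
  shows "skew_frame g L W (u(dim {x \<in> W. g v x = 0} := v)) r b"
proof -
  let ?U = "{x \<in> W. g v x = 0}"
  have d: "dim W = Suc (dim ?U)"
    using dim_bilinear_orthogonal[OF g W v(1)] v(2) by simp
  have o: "g v (u i) = 0" "g (u i) v = 0" if "i < dim ?U" for i
    using u that sym[of "u i" v] by (auto simp: skew_frame_def)
  have r: "2 * r \<le> dim ?U" using u by (simp add: skew_frame_def)
  show ?thesis
    unfolding skew_frame_def d
  proof (intro conjI allI impI)
    fix i j assume "i < Suc (dim ?U)" "j < Suc (dim ?U)"
    then show "g ((u(dim ?U := v)) i) ((u(dim ?U := v)) j) = (if i = j then 1 else 0)"
      using u v(2) o by (auto simp: skew_frame_def less_Suc_eq)
  qed (use u v r in \<open>auto simp: skew_frame_def less_Suc_eq\<close>)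
qed

text \<open>A new plane goes in front: all old indices shift by two, so pairs stay pairs and the
  kernel vectors stay last.\<close>

lemma skew_frame_prepend:
  assumes g: "bilinear g" and sym: "\<And>x y. g x y = g y x" and W: "subspace W"
    and v: "v \<in> W" "w \<in> W" "g v v = 1" "g w w = 1" "g v w = 0"
    and L: "L v = c *\<^sub>R w" "L w = - c *\<^sub>R v"
    and u: "skew_frame g L {x \<in> {x \<in> W. g v x = 0}. g w x = 0} u r b"
  shows "skew_frame g L W (case_nat v (case_nat w u)) (Suc r) (case_nat c b)"
proof -
  let ?U = "{x \<in> W. g v x = 0}"
  let ?X = "{x \<in> ?U. g w x = 0}"
  have "dim W = Suc (dim ?U)"
    using dim_bilinear_orthogonal[OF g W v(1)] v(3) by simp
  moreover have "dim ?U = Suc (dim ?X)"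
    using dim_bilinear_orthogonal[OF g subspace_bilinear_orthogonal[OF g W], of w v] v by simp
  ultimately have d: "dim W = Suc (Suc (dim ?X))" by simp
  have uX: "u i \<in> ?X" if "i < dim ?X" for i
    using u that unfolding skew_frame_def by blast
  have o: "g v (u i) = 0" "g (u i) v = 0" "g w (u i) = 0" "g (u i) w = 0" "g w v = 0" "u i \<in> W"
    if "i < dim ?X" for i
    using uX[OF that] sym[of "u i" v] sym[of "u i" w] v(5) sym[of w v] by auto
  show ?thesis
    unfolding skew_frame_def d
  proof (intro conjI allI impI)
    fix i j assume "i < Suc (Suc (dim ?X))" "j < Suc (Suc (dim ?X))"
    then show "g ((case_nat v (case_nat w u)) i) ((case_nat v (case_nat w u)) j) = (if i = j then 1 else 0)"
      using u v o sym[of w v] unfolding skew_frame_def by (auto split: nat.split)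
  next
    fix i assume "i < Suc r"
    then show "L (case_nat v (case_nat w u) (2*i)) = case_nat c b i *\<^sub>R case_nat v (case_nat w u) (2*i+1)"
       "L (case_nat v (case_nat w u) (2*i+1)) = - case_nat c b i *\<^sub>R case_nat v (case_nat w u) (2*i)"
      using u L unfolding skew_frame_def by (auto split: nat.split)
  next
    fix i assume "i < Suc (Suc (dim ?X))" "2 * Suc r \<le> i"
    then show "L (case_nat v (case_nat w u) i) = 0"
      using u unfolding skew_frame_def by (auto split: nat.split)
  next
    fix i assume "i < Suc (Suc (dim ?X))"
    then show "case_nat v (case_nat w u) i \<in> W"
      using v o by (auto split: nat.split)
  next
    show "2 * Suc r \<le> Suc (Suc (dim ?X))" using u by (simp add: skew_frame_def)
  qed
qed

text \<open>Induction on the dimension. A kernel vector is split off if there is one; otherwise an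
  eigenvector of the square of \<open>L\<close> and its image span an invariant plane. By skewness
  the orthogonal complement is invariant in both cases.\<close>

lemma skew_frame_exists:
  fixes g :: "'a::euclidean_space \<Rightarrow> 'a \<Rightarrow> real"
  assumes g: "bilinear g" and sym: "\<And>x y. g x y = g y x" and L: "linear L"
    and W: "subspace W" and pos: "\<And>x. x \<in> W \<Longrightarrow> x \<noteq> 0 \<Longrightarrow> g x x > 0"
    and LW: "\<And>x. x \<in> W \<Longrightarrow> L x \<in> W"
    and skew: "\<And>x y. x \<in> W \<Longrightarrow> y \<in> W \<Longrightarrow> g (L x) y = - g x (L y)"
  shows "\<exists>u r b. skew_frame g L W u r b"
  using W pos LW skew
proof (induction "dim W" arbitrary: W rule: less_induct)
  case less
  note be = bilinear_expand[OF g] and le = linear_add[OF L] linear_scale[OF L]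
  note W = less.prems(1) and pos = less.prems(2) and LW = less.prems(3) and skew = less.prems(4)
  show ?case
  proof (cases "W = {0}")
    case True
    then have "skew_frame g L W (\<lambda>_. 0) 0 (\<lambda>_. 0)" by (simp add: skew_frame_def)
    then show ?thesis by blast
  next
    case False
    then obtain w where w: "w \<in> W" "w \<noteq> 0" using W subspace_0 by blast
    show ?thesis
    proof (cases "\<exists>v\<in>W. v \<noteq> 0 \<and> L v = 0")
      case True
      then obtain v0 where v0: "v0 \<in> W" "v0 \<noteq> 0" "L v0 = 0" by blast
      define v where "v = (1 / sqrt (g v0 v0)) *\<^sub>R v0"
      have v: "v \<in> W" "g v v = 1" "L v = 0"
        using v0 pos[OF v0(1,2)] W by (auto simp: v_def be le subspace_scale)
      let ?U = "{x \<in> W. g v x = 0}"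
      have "dim ?U < dim W" using dim_bilinear_orthogonal[OF g W v(1)] v(2) by simp
      moreover have "L x \<in> ?U" if "x \<in> ?U" for x
        using that LW skew[of v x] v by (auto simp: be)
      ultimately obtain u r b where "skew_frame g L ?U u r b"
        using less.hyps[of ?U] subspace_bilinear_orthogonal[OF g W] pos skew by auto
      then show ?thesis using skew_frame_append[where L = L, OF g sym W v] by blast
    next
      case inj: False
      obtain v0 where v0: "v0 \<in> W" "v0 \<noteq> 0" "L (L v0) = - (g (L v0) (L v0) / g v0 v0) *\<^sub>R v0"
        by (rule skew_square_eigenvector[OF g sym W pos L LW skew w])
      \<comment> \<open>The rotation rate: \<open>- c * c\<close> is the eigenvalue of the square of
        \<open>L\<close> at \<open>v0\<close>.\<close>
      define c where "c = sqrt (g (L v0) (L v0) / g v0 v0)"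
      have Lv0: "g (L v0) (L v0) > 0" using v0 inj LW pos by blast
      have c: "c > 0" "c * c = g (L v0) (L v0) / g v0 v0"
        using Lv0 pos[OF v0(1,2)] by (auto simp: c_def)
      define v where "v = (1 / sqrt (g v0 v0)) *\<^sub>R v0"
      define z where "z = (1 / c) *\<^sub>R L v"
      have v: "v \<in> W" "g v v = 1"
        using v0 pos[OF v0(1,2)] W by (auto simp: v_def be le subspace_scale)
      have z: "z \<in> W" using v LW W by (auto simp: z_def subspace_scale)
      have Lv: "L v = c *\<^sub>R z" using c by (simp add: z_def)
      have Lz: "L z = - c *\<^sub>R v"
        using c(1) by (simp add: z_def v_def le v0(3) c(2)[symmetric])
      have vz: "g v z = 0"
        using skew[of v v] v sym[of v "L v"] by (simp add: z_def be)
      \<comment> \<open>Skewness between \<open>v\<close> and \<open>z\<close> compares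
        \<open>c * g z z\<close> with \<open>c * g v v\<close>, so \<open>z\<close> is a unit
        vector.\<close>
      have "c * g z z = c"
        using skew[of v z] v z Lv Lz by (simp add: be)
      then have zz: "g z z = 1" using c by simp
      let ?U = "{x \<in> W. g v x = 0}"
      let ?X = "{x \<in> ?U. g z x = 0}"
      have sU: "subspace ?U" by (rule subspace_bilinear_orthogonal[OF g W])
      have "dim ?U < dim W" using dim_bilinear_orthogonal[OF g W v(1)] v(2) by simp
      moreover have "dim ?X < dim ?U"
        using dim_bilinear_orthogonal[OF g sU, of z] zz z vz by simp
      ultimately have "dim ?X < dim W" by simp
      moreover have "L x \<in> ?X" if "x \<in> ?X" for x
        using that LW skew[of v x] skew[of z x] v z Lv Lz by (auto simp: be)
      ultimately obtain u r b where "skew_frame g L ?X u r b"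
        using less.hyps[of ?X] subspace_bilinear_orthogonal[OF g sU] pos skew by auto
      then show ?thesis using skew_frame_prepend[where L = L, OF g sym W v(1) z v(2) zz vz Lv Lz] by blast
    qed
  qed
qed

text \<open>On the image of \<open>L\<close> in \<open>W\<close> the map \<open>L\<close> is injective, hence surjective.\<close>

lemma skew_kernel_translation:
  fixes g :: "'a::euclidean_space \<Rightarrow> 'a \<Rightarrow> real"
  assumes g: "bilinear g" and L: "linear L"
    and W: "subspace W" and pos: "\<And>x. x \<in> W \<Longrightarrow> x \<noteq> 0 \<Longrightarrow> g x x > 0"
    and LW: "\<And>x. x \<in> W \<Longrightarrow> L x \<in> W"
    and skew: "\<And>x y. x \<in> W \<Longrightarrow> y \<in> W \<Longrightarrow> g (L x) y = - g x (L y)"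
    and l: "l \<in> W"
  obtains p where "p \<in> W" "L (L p + l) = 0"
proof -
  note be = bilinear_expand[OF g]
  have sub: "subspace (L ` W)" using L W by (rule linear_subspace_image)
  have "L x = 0" if x: "x \<in> W" "L (L x) = 0" for x
    using skew[of x "L x"] x LW pos[of "L x"] by (force simp: be)
  then have "inj_on L (L ` W)"
    using linear_injective_on_subspace_0[OF L sub] by auto
  then have "dim (L ` L ` W) = dim (L ` W)"
    using dim_image_eq[of L "L ` W"] L sub by (simp add: span_eq_iff[THEN iffD2])
  moreover have "L ` L ` W \<subseteq> L ` W" using LW by auto
  ultimately have "L ` L ` W = L ` W"
    using subspace_dim_equal[OF linear_subspace_image[OF L sub] sub] by simp
  then have "L l \<in> L ` L ` W" using l by simp
  then obtain q where q: "q \<in> W" "L (L q) = L l" by (auto dest: sym)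
  then show thesis
    using that[of "- q"] W L by (simp add: subspace_neg linear_neg linear_diff)
qed

text \<open>After the translation the remainder \<open>L p + l\<close> lies in the kernel; if
  nonzero, its normalisation is taken as last frame vector. For \<open>dim W = 0\<close> the index
  \<open>dim W - 1\<close> is 0, where \<open>u\<close> is unconstrained, hence the separate clause
  on \<open>q\<close>.\<close>

lemma skew_affine_frame:
  fixes g :: "'a::euclidean_space \<Rightarrow> 'a \<Rightarrow> real"
  assumes g: "bilinear g" and sym: "\<And>x y. g x y = g y x" and L: "linear L"
    and W: "subspace W" and pos: "\<And>x. x \<in> W \<Longrightarrow> x \<noteq> 0 \<Longrightarrow> g x x > 0"
    and LW: "\<And>x. x \<in> W \<Longrightarrow> L x \<in> W"
    and skew: "\<And>x y. x \<in> W \<Longrightarrow> y \<in> W \<Longrightarrow> g (L x) y = - g x (L y)"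
    and l: "l \<in> W"
  obtains p u r b q where "p \<in> W" "skew_frame g L W u r b"
    "L p + l = q *\<^sub>R u (dim W - 1)" "dim W = 0 \<longrightarrow> q = 0" "L (L p + l) = 0"
proof -
  note be = bilinear_expand[OF g] and le = linear_add[OF L] linear_scale[OF L]
  obtain p where p: "p \<in> W" "L (L p + l) = 0"
    by (rule skew_kernel_translation[OF g L W pos LW skew l])
  let ?w = "L p + l"
  have w: "?w \<in> W" using p W LW l by (auto simp: subspace_add)
  show thesis
  proof (cases "?w = 0")
    case True
    with skew_frame_exists[OF g sym L W pos LW skew] p that[of p _ _ _ 0] show thesis by auto
  next
    case False
    define v where "v = (1 / sqrt (g ?w ?w)) *\<^sub>R ?w"
    have "g ?w ?w > 0" using pos[OF w False] .
    then have v: "v \<in> W" "g v v = 1" "L v = 0"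
      using w p(2) W by (simp_all add: v_def be(3,4) le(2) subspace_scale)
    have wv: "?w = sqrt (g ?w ?w) *\<^sub>R v" using \<open>g ?w ?w > 0\<close> by (simp add: v_def)
    let ?U = "{x \<in> W. g v x = 0}"
    have d: "dim ?U + 1 = dim W" using dim_bilinear_orthogonal[OF g W v(1)] v(2) by simp
    have "L x \<in> ?U" if "x \<in> ?U" for x
      using that LW skew[of v x] v by (auto simp: be)
    then obtain u r b where "skew_frame g L ?U u r b"
      using skew_frame_exists[OF g sym L subspace_bilinear_orthogonal[OF g W]] pos skew
      by (metis (no_types, lifting) mem_Collect_eq)
    note f = skew_frame_append[where L = L, OF g sym W v this]
    have "?w = sqrt (g ?w ?w) *\<^sub>R (u(dim ?U := v)) (dim W - 1)"
      using wv d[symmetric] by simp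
    then show thesis using that[OF p(1) f] d p(2) by fastforce
  qed
qed

subsection \<open>Skew maps of a Lorentzian form\<close>

text \<open>Signature with exactly one minus sign, stated without a basis: a timelike vector exists,
  and the complement of every timelike vector is positive definite.\<close>

locale lorentzian_form =
  fixes g :: "'a::euclidean_space \<Rightarrow> 'a \<Rightarrow> real"
  assumes bilinear: "bilinear g"
    and sym: "g x y = g y x"
    and timelike_exists: "\<exists>v. g v v < 0"
    and orthogonal_timelike: "g v v < 0 \<Longrightarrow> g v x = 0 \<Longrightarrow> x \<noteq> 0 \<Longrightarrow> g x x > 0"
begin

lemmas expand = bilinear_expand[OF bilinear]

definition skew :: "('a \<Rightarrow> 'a) \<Rightarrow> bool"
  where "skew L \<longleftrightarrow> linear L \<and> (\<forall>x y. g (L x) y = - g x (L y))"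

lemma skew_linear: "skew L \<Longrightarrow> linear L"
  by (simp add: skew_def)

lemma skewD: "skew L \<Longrightarrow> g (L x) y = - g x (L y)"
  by (simp add: skew_def)

lemma skew_self: "skew L \<Longrightarrow> g x (L x) = 0"
  using skewD[of L x x] sym[of x "L x"] by simp

lemma nondegenerate:
  assumes "\<And>y. g x y = 0"
  shows "x = 0"
  using timelike_exists orthogonal_timelike assms sym by (metis less_irrefl)

text \<open>The combination \<open>?z\<close> orthogonal to a timelike vector is still null, hence
  zero. This is what bounds totally isotropic subspaces by dimension 1.\<close>

lemma null_orthogonal_proportional:
  assumes "g x x = 0" "g y y = 0" "g x y = 0" "x \<noteq> 0"
  obtains c where "y = c *\<^sub>R x"
proof -
  obtain v where v: "g v v < 0" using timelike_exists by blast
  have a: "g v x \<noteq> 0" using orthogonal_timelike[OF v _ assms(4)] assms(1) by auto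
  let ?z = "g v x *\<^sub>R y - g v y *\<^sub>R x"
  have "g v ?z = 0" by (simp add: expand)
  moreover have "g ?z ?z = 0" using assms sym[of y x] by (simp add: expand)
  ultimately have "?z = 0" using orthogonal_timelike[OF v] by force
  then have "y = (g v y / g v x) *\<^sub>R x"
    using a by (simp add: eq_vector_fraction_iff)
  then show thesis by (rule that)
qed

lemma orthogonal_null_nonneg:
  assumes "g x x = 0" "g x y = 0" "x \<noteq> 0"
  shows "g y y \<ge> 0"
  using orthogonal_timelike[of y x] assms sym[of x y] by force

text \<open>\<open>L - 1\<close> is minus the adjoint of \<open>L + 1\<close>, so both are singular.\<close>

lemma opposite_eigenvector:
  assumes L: "skew L" and N: "L N = N" "N \<noteq> 0"
  obtains M where "L M = - M" "g N N = 0" "g M M = 0" "g N M = - 2"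
proof -
  note lin = skew_linear[OF L]
  let ?T = "\<lambda>x. L x + x"
  have T: "linear ?T" using lin linear_compose_add linear_id by (auto simp: id_def)
  have "\<not> inj ?T"
  proof
    assume "inj ?T"
    then have "surj ?T" by (rule linear_injective_imp_surjective[OF T _ refl])
    \<comment> \<open>By skewness and \<open>L N = N\<close>, the vector \<open>N\<close> is
      orthogonal to the whole image of \<open>L + 1\<close>.\<close>
    have "g N z = 0" for z
    proof -
      obtain y where "z = L y + y" using surjD[OF \<open>surj ?T\<close>, of z] by blast
      then show ?thesis using skewD[OF L, of N y] N by (simp add: expand)
    qed
    then show False using nondegenerate N by blast
  qed
  then obtain M where M: "L M = - M" "M \<noteq> 0"
    using linear_injective_0[OF T] by (auto simp: add_eq_0_iff2)
  have NN: "g N N = 0" using skew_self[OF L, of N] N by simp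
  have MM: "g M M = 0" using skew_self[OF L, of M] M by (simp add: expand)
  have NM: "g N M \<noteq> 0"
  proof
    assume "g N M = 0"
    then obtain c where c: "M = c *\<^sub>R N" using null_orthogonal_proportional[OF NN MM _ N(2)] by blast
    have LM: "L M = M" unfolding c using N(1) lin by (simp add: linear_scale)
    have "- M = M" using M(1)[symmetric] LM by (rule trans)
    then have "2 *\<^sub>R M = 0" by (simp add: scaleR_2 neg_eq_iff_add_eq_0)
    then show False using M(2) by simp
  qed
  \<comment> \<open>The factor makes the product with \<open>N\<close> equal to -2, so that half the
    sum and half the difference have squares -1 and 1.\<close>
  show thesis
    by (rule that[of "(- 2 / g N M) *\<^sub>R M"]) (use M NN MM NM lin in \<open>simp_all add: expand linear_scale linear_neg\<close>)
qed

section \<open>Lorentz frames, and the adapted frame for a translation field\<close>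

definition lorentz_frame :: "(nat \<Rightarrow> 'a) \<Rightarrow> nat \<Rightarrow> bool"
  where "lorentz_frame f n \<longleftrightarrow>
    (\<forall>i\<le>n. \<forall>j\<le>n. g (f i) (f j) = (if i = j then if i = 0 then - 1 else 1 else 0))"

text \<open>\<open>W\<close> is the complement of the unit timelike \<open>?s\<close> and the unit
  spacelike \<open>?d\<close>: two dimension counts apply, and \<open>?s\<close> supplies
  definiteness.\<close>

lemma null_pair_complement:
  assumes NM: "g N N = 0" "g M M = 0" "g N M = - 2"
  defines "W \<equiv> {x. g N x = 0 \<and> g M x = 0}"
  shows "subspace W" "dim W + 2 = DIM('a)" "\<And>x. x \<in> W \<Longrightarrow> x \<noteq> 0 \<Longrightarrow> g x x > 0"
proof -
  let ?s = "(1/2) *\<^sub>R (N + M)" and ?d = "(1/2) *\<^sub>R (N - M)"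
  note MN = NM(3)[unfolded sym[of N M]]
  let ?U = "{x \<in> UNIV. g ?s x = 0}"
  have s: "g ?s ?s = - 1" "g ?d ?d = 1" "g ?s ?d = 0"
    using NM MN by (simp_all add: expand)
  have W: "W = {x \<in> ?U. g ?d x = 0}" by (auto simp: W_def expand)
  have U: "subspace ?U" by (rule subspace_bilinear_orthogonal[OF bilinear subspace_UNIV])
  show "subspace W" unfolding W by (rule subspace_bilinear_orthogonal[OF bilinear U])
  have "dim ?U + 1 = DIM('a)"
    using dim_bilinear_orthogonal[OF bilinear subspace_UNIV, of ?s] s
    by simp
  moreover have "dim W + 1 = dim ?U"
    unfolding W by (rule dim_bilinear_orthogonal[OF bilinear U]) (use s in auto)
  ultimately show "dim W + 2 = DIM('a)" by simp
  show "g x x > 0" if "x \<in> W" "x \<noteq> 0" for x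
    using orthogonal_timelike[of ?s x] that s unfolding W by auto
qed

text \<open>On the plane of \<open>N\<close> and its opposite null eigenvector, \<open>L\<close> is
  a boost exchanging \<open>f 0\<close> and \<open>f 1\<close>; the complement is definite and
  invariant, so the affine normal form applies there.\<close>

lemma boost_translation_frame:
  assumes L: "skew L" and N: "L N = N" "N \<noteq> 0" and n: "DIM('a) = n + 1"
  shows "\<exists>p f r b q. lorentz_frame f n \<and> 2 * r + 1 \<le> n \<and> f 0 + f 1 = N \<and>
    L p + l = q *\<^sub>R f n \<and> L (f 0) = f 1 \<and> L (f 1) = f 0 \<and>
    (\<forall>i<r. L (f (2*i+2)) = b i *\<^sub>R f (2*i+3) \<and> L (f (2*i+3)) = - b i *\<^sub>R f (2*i+2)) \<and>
    (\<forall>i\<le>n. 2*r+2 \<le> i \<longrightarrow> L (f i) = 0)"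
proof -
  note lin = skew_linear[OF L] and skew = skewD[OF L]
  note le = linear_add[OF lin] linear_diff[OF lin] linear_scale[OF lin]
  obtain M where M: "L M = - M" and NM: "g N N = 0" "g M M = 0" "g N M = - 2"
    by (rule opposite_eigenvector[OF L N])
  have MN: "g M N = - 2" using NM(3) sym[of M N] by simp
  define W where "W = {x. g N x = 0 \<and> g M x = 0}"
  note W = null_pair_complement[OF NM, folded W_def]
  have LW: "L x \<in> W" if "x \<in> W" for x
    using that skew[of N x] skew[of M x] N M by (simp add: W_def expand)
  \<comment> \<open>The coefficients of \<open>l\<close> along \<open>N\<close> and
    \<open>M\<close>; the divisor 2 comes from \<open>g N M = - 2\<close>.\<close>
  define \<alpha> \<beta> where "\<alpha> = - g M l / 2" and "\<beta> = - g N l / 2"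
  have w: "l - \<alpha> *\<^sub>R N - \<beta> *\<^sub>R M \<in> W" (is "?w \<in> W")
    using NM MN by (simp add: W_def expand \<alpha>_def \<beta>_def)
  obtain p u r b q where p: "p \<in> W" and u: "skew_frame g L W u r b"
    and q: "L p + ?w = q *\<^sub>R u (dim W - 1)" "dim W = 0 \<longrightarrow> q = 0"
    by (rule skew_affine_frame[OF bilinear sym lin W(1,3) LW skew w])
  define f where "f = case_nat ((1/2) *\<^sub>R (N + M)) (case_nat ((1/2) *\<^sub>R (N - M)) u)"
  have f: "f 0 = (1/2) *\<^sub>R (N + M)" "f (Suc 0) = (1/2) *\<^sub>R (N - M)" "f (Suc (Suc i)) = u i" for i
    by (simp_all add: f_def)
  have d: "n = Suc (dim W)" using W(2) n by simp
  have o: "g N (u i) = 0" "g (u i) N = 0" "g M (u i) = 0" "g (u i) M = 0" if "i < dim W" for i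
  proof -
    have "u i \<in> W" using u that by (simp add: skew_frame_def)
    then show "g N (u i) = 0" "g (u i) N = 0" "g M (u i) = 0" "g (u i) M = 0"
      using sym[of "u i"] by (simp_all add: W_def)
  qed
  show ?thesis
  proof (intro exI conjI)
    show "lorentz_frame f n"
      unfolding lorentz_frame_def
    proof (intro allI impI)
      fix i j assume "i \<le> n" "j \<le> n"
      then show "g (f i) (f j) = (if i = j then if i = 0 then - 1 else 1 else 0)"
        using u o NM MN unfolding d skew_frame_def f_def
        by (auto simp: expand split: nat.split)
    qed
    show "2 * r + 1 \<le> n" using u d by (simp add: skew_frame_def)
    show "f 0 + f 1 = N" by (simp add: f algebra_simps flip: scaleR_add_left)
    \<comment> \<open>As \<open>N\<close> and \<open>M\<close> have eigenvalues 1 and -1, this shift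
      cancels both null components of \<open>l\<close>.\<close>
    have "L (p - \<alpha> *\<^sub>R N + \<beta> *\<^sub>R M) + l = L p + ?w" using N M by (simp add: le)
    also have "\<dots> = q *\<^sub>R f n" using q d by (cases "dim W") (simp_all add: f)
    finally show "L (p - \<alpha> *\<^sub>R N + \<beta> *\<^sub>R M) + l = q *\<^sub>R f n" .
    show "L (f 0) = f 1" "L (f 1) = f 0" using N M by (simp_all add: f le)
    show "\<forall>i<r. L (f (2*i+2)) = b i *\<^sub>R f (2*i+3) \<and> L (f (2*i+3)) = - b i *\<^sub>R f (2*i+2)"
      using u by (simp add: skew_frame_def f eval_nat_numeral)
    show "\<forall>i\<le>n. 2*r+2 \<le> i \<longrightarrow> L (f i) = 0"
      using u unfolding d skew_frame_def f_def by (auto split: nat.split)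
  qed
qed

section \<open>Nilpotent skew maps and null rotations\<close>

text \<open>An odd power \<open>?M\<close> of \<open>K\<close> is again skew, and with square zero
  its image is totally isotropic, so at most a line. Then \<open>g (?M x) y\<close> is a multiple of
  \<open>g x (?M x) = 0\<close>, against nondegeneracy.\<close>

lemma skew_odd_power_zero:
  assumes K: "skew K" and i: "odd i" and zero: "\<And>x. (K ^^ (2*i)) x = 0"
  shows "(K ^^ i) x = 0"
proof -
  let ?M = "K ^^ i"
  have pow: "g ((K ^^ j) x) y = (- 1) ^ j * g x ((K ^^ j) y)" for j x y
    by (induction j arbitrary: y) (simp_all add: skewD[OF K] flip: funpow_swap1)
  have M: "g (?M x) y = - g x (?M y)" for x y using pow[of i] i by simp
  have MM: "?M (?M x) = 0" for x using zero[of x] by (simp add: mult_2 funpow_add)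
  have null: "g (?M x) (?M y) = 0" for x y using M[of x "?M y"] MM by (simp add: expand)
  show ?thesis
  proof (rule ccontr)
    assume N: "?M x \<noteq> 0"
    have "g (?M x) y = 0" for y
    proof -
      obtain c where "?M y = c *\<^sub>R ?M x"
        using null_orthogonal_proportional[OF null null null N] by blast
      moreover have "g x (?M x) = 0" using M[of x x] sym[of x "?M x"] by linarith
      ultimately show ?thesis by (subst M) (simp add: expand)
    qed
    then show False using nondegenerate N by blast
  qed
qed

text \<open>\<open>[L, K\<^sup>j] = j K\<^sup>j\<close> forces \<open>j \<parallel>K\<^sup>j\<parallel> \<le> 2 \<parallel>L\<parallel> \<parallel>K\<^sup>j\<parallel>\<close>.\<close>

lemma commutator_eigenvector_nilpotent:
  fixes L K :: "'b::euclidean_space \<Rightarrow> 'b"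
  assumes L: "linear L" and K: "linear K" and comm: "\<And>x. L (K x) - K (L x) = K x"
  obtains j where "\<And>x. (K ^^ j) x = 0"
proof -
  have lin: "linear (K ^^ j)" for j
    by (induction j) (auto intro!: linearI simp: linear_add linear_scale linear_add[OF K] linear_scale[OF K])
  have bl: "bounded_linear (K ^^ j)" for j
    using lin linear_conv_bounded_linear by blast
  have bL: "bounded_linear L" using L linear_conv_bounded_linear by blast
  have c: "L ((K ^^ j) x) - (K ^^ j) (L x) = real j *\<^sub>R (K ^^ j) x" for j x
  proof (induction j)
    case 0
    then show ?case by simp
  next
    case (Suc j)
    have "L (K ((K ^^ j) x)) = K (L ((K ^^ j) x)) + K ((K ^^ j) x)"
      using comm[of "(K ^^ j) x"] by (simp add: algebra_simps)
    also have "L ((K ^^ j) x) = (K ^^ j) (L x) + real j *\<^sub>R (K ^^ j) x"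
      using Suc by (simp add: algebra_simps)
    finally show ?case by (simp add: linear_add[OF K] linear_scale[OF K] algebra_simps)
  qed
  define C where "C = onorm L"
  \<comment> \<open>Beyond \<open>2 * C\<close> the factor \<open>2 * C / real j\<close> drops below
    1, which forces the norm \<open>m\<close> to vanish.\<close>
  obtain j :: nat where j: "real j > 2 * C" using reals_Archimedean2 by blast
  have C: "C \<ge> 0" using onorm_pos_le[OF bL] by (simp add: C_def)
  then have j0: "real j > 0" using j by simp
  define m where "m = onorm (K ^^ j)"
  have m: "m \<ge> 0" using onorm_pos_le[OF bl] by (simp add: m_def)
  have "m \<le> 2 * C / real j * m"
    unfolding m_def
  proof (rule onorm_le)
    fix x
    have "real j * norm ((K ^^ j) x) = norm (L ((K ^^ j) x) - (K ^^ j) (L x))" by (simp add: c)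
    also have "\<dots> \<le> norm (L ((K ^^ j) x)) + norm ((K ^^ j) (L x))" by (rule norm_triangle_ineq4)
    also have "\<dots> \<le> C * norm ((K ^^ j) x) + m * norm (L x)"
      using onorm[OF bL] onorm[OF bl] unfolding C_def m_def by (intro add_mono) auto
    also have "\<dots> \<le> C * (m * norm x) + m * (C * norm x)"
      using onorm[OF bL] onorm[OF bl] C m unfolding C_def m_def
      by (intro add_mono mult_left_mono) auto
    finally show "norm ((K ^^ j) x) \<le> 2 * C / real j * onorm (K ^^ j) * norm x"
      using j0 by (simp add: field_simps m_def)
  qed
  moreover have "2 * C / real j < 1" using j j0 by simp
  ultimately have "m = 0" using m mult_strict_right_mono[of "2 * C / real j" 1 m] by fastforce
  then show thesis using that[of j] onorm_eq_0[OF bl] by (simp add: m_def)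
qed

text \<open>Let \<open>s\<close> be the least vanishing exponent. If \<open>s\<close> is at least 4,
  then \<open>s - 2\<close> or \<open>s - 1\<close> is odd, smaller than \<open>s\<close> and at
  least half of it, so the power already vanishes there.\<close>

lemma skew_nilpotent_cube_zero:
  assumes K: "skew K" and nil: "\<And>x. (K ^^ j) x = 0"
  shows "K (K (K x)) = 0"
proof -
  define s where "s = (LEAST j. \<forall>x. (K ^^ j) x = 0)"
  have s: "(K ^^ s) x = 0" for x
    using LeastI[of "\<lambda>j. \<forall>x. (K ^^ j) x = 0" j] nil by (simp add: s_def)
  have up: "(K ^^ j) x = 0" if "s \<le> j" for j x
  proof -
    have "(K ^^ j) x = (K ^^ s) ((K ^^ (j - s)) x)"
      using that by (metis comp_apply funpow_add le_add_diff_inverse)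
    then show ?thesis using s by simp
  qed
  have odd: "s \<le> i" if "odd i" "s \<le> 2 * i" for i
    using skew_odd_power_zero[OF K that(1)] up[OF that(2)]
    by (auto simp: s_def intro: Least_le)
  have "s \<le> 3"
  proof (rule ccontr)
    assume s4: "\<not> s \<le> 3"
    show False
    proof (cases "odd s")
      case True
      then have "odd (s - 2)" using s4 by presburger
      then show False using odd[of "s - 2"] s4 by arith
    next
      case False
      then have "odd (s - 1)" using s4 by presburger
      then show False using odd[of "s - 1"] s4 by arith
    qed
  qed
  from up[OF this] show ?thesis by (simp add: eval_nat_numeral)
qed

text \<open>The image of \<open>K\<^sup>2\<close> is totally isotropic, hence a null line.\<close>

lemma skew_nilpotent_square:
  assumes K: "skew K" and cube: "\<And>x. K (K (K x)) = 0" and K0: "K x0 \<noteq> 0"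
  obtains N where "N \<noteq> 0" "\<And>x. K (K x) = - g N x *\<^sub>R N"
proof -
  note lin = skew_linear[OF K] and skew = skewD[OF K]
  have "\<exists>x. K (K x) \<noteq> 0"
    using skew_odd_power_zero[OF K, of 1 x0] K0 by (auto simp: eval_nat_numeral)
  then obtain x where x: "K (K x) \<noteq> 0" by blast
  define N where "N = K (K x)"
  have N: "N \<noteq> 0" "K N = 0" using x cube by (auto simp: N_def)
  have null: "g (K (K y)) (K (K z)) = 0" for y z
    using skew[of "K y" "K (K z)"] cube by (simp add: expand)
  define d where "d = g x N"
  have line: "\<exists>c. K (K y) = c *\<^sub>R N" for y
    using null_orthogonal_proportional[of N "K (K y)"] null N unfolding N_def by blast
  have gN: "g N y = g x (K (K y))" for y
    using skew[of "K x" y] skew[of x "K y"] by (simp add: N_def)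
  have d0: "d \<noteq> 0"
  proof
    assume "d = 0"
    then have "g N y = 0" for y using gN[of y] line[of y] by (auto simp: expand d_def)
    then show False using nondegenerate N by blast
  qed
  \<comment> \<open>The sign of \<open>d\<close>: \<open>K x\<close> is orthogonal to the null
    vector \<open>N\<close>, so it cannot be timelike.\<close>
  have "g (K x) (K x) = - d" using skew[of x "K x"] by (simp add: d_def N_def)
  moreover have "g N (K x) = 0" using skew_self[OF K, of "K x"] sym by (simp add: N_def)
  then have "g (K x) (K x) \<ge> 0" using orthogonal_null_nonneg[of N "K x"] null[of x x] N by (simp add: N_def)
  ultimately have d: "d < 0" using d0 by simp
  have KK: "K (K y) = (g N y / d) *\<^sub>R N" for y
    using line[of y] gN[of y] d0 by (auto simp: expand d_def)
  show thesis
  \<comment> \<open>Rescaling \<open>N\<close> turns the coefficient \<open>1 / d\<close> into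
    -1.\<close>
  proof (rule that[of "(1 / sqrt (- d)) *\<^sub>R N"])
    show "(1 / sqrt (- d)) *\<^sub>R N \<noteq> 0" using N d by simp
    show "K (K y) = - g ((1 / sqrt (- d)) *\<^sub>R N) y *\<^sub>R (1 / sqrt (- d)) *\<^sub>R N" for y
      using d by (simp add: KK expand field_simps)
  qed
qed

text \<open>\<open>N\<close>, \<open>M\<close> and \<open>h\<close> span a three-dimensional
  Minkowski space on which \<open>K\<close> is a null rotation and \<open>L\<close> a boost.
  \<open>K\<close> vanishes on its complement \<open>V\<close>, where the affine normal form of
  \<open>L\<close> applies.\<close>

lemma null_rotation_frame:
  assumes L: "skew L" and K: "skew K" and comm: "\<And>x. L (K x) - K (L x) = K x"
    and K0: "K x0 \<noteq> 0" and lk: "L k - K l = k" and n: "DIM('a) = n + 1"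
  shows "\<exists>p f r b q. lorentz_frame f n \<and> 2 * r + 2 \<le> n \<and> K p + k = 0 \<and>
    L p + l = q *\<^sub>R f n \<and> K (f 0) = f 1 \<and> K (f 1) = f 0 + f 2 \<and> K (f 2) = - f 1 \<and>
    (\<forall>i\<le>n. 3 \<le> i \<longrightarrow> K (f i) = 0) \<and> L (f 0) = f 2 \<and> L (f 1) = 0 \<and> L (f 2) = f 0 \<and>
    (\<forall>i<r. L (f (2*i+3)) = b i *\<^sub>R f (2*i+4) \<and> L (f (2*i+4)) = - b i *\<^sub>R f (2*i+3)) \<and>
    (\<forall>i\<le>n. 2*r+3 \<le> i \<longrightarrow> L (f i) = 0)"
proof -
  note lin = skew_linear[OF L] skew_linear[OF K] and skL = skewD[OF L] and skK = skewD[OF K]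
  note le = linear_add[OF lin(1)] linear_diff[OF lin(1)] linear_scale[OF lin(1)] linear_neg[OF lin(1)] linear_0[OF lin(1)]
    linear_add[OF lin(2)] linear_diff[OF lin(2)] linear_scale[OF lin(2)] linear_neg[OF lin(2)] linear_0[OF lin(2)]
  obtain j where "\<And>x. (K ^^ j) x = 0"
    using commutator_eigenvector_nilpotent[OF lin comm] by blast
  note cube = skew_nilpotent_cube_zero[OF K this]
  obtain N where N0: "N \<noteq> 0" and KK: "\<And>x. K (K x) = - g N x *\<^sub>R N"
    using skew_nilpotent_square[OF K cube K0] by metis
  obtain z where z: "g N z \<noteq> 0" using nondegenerate N0 by blast
  have KN: "K N = 0"
    using cube[of z] z by (simp add: KK le)
  have LN: "L N = N"
  proof -
    have LK: "L (K x) = K (L x) + K x" for x using comm[of x] by (simp add: algebra_simps)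
    have LKK: "L (K (K x)) = K (K (L x)) + 2 *\<^sub>R K (K x)" for x
      by (simp add: LK le scaleR_2)
    \<comment> \<open>The relation for the square of \<open>K\<close>, rewritten through
      \<open>N\<close>. It makes \<open>L N\<close> a multiple \<open>\<mu>\<close> of
      \<open>N\<close>, and then \<open>\<mu> = - \<mu> + 2\<close>.\<close>
    have rel: "g N x *\<^sub>R L N = - g (L N) x *\<^sub>R N + (2 * g N x) *\<^sub>R N" for x
    proof -
      have "g N (L x) = - g (L N) x" using skL[of N x] by simp
      then have "- (g N x *\<^sub>R L N) = g (L N) x *\<^sub>R N - (2 * g N x) *\<^sub>R N"
        using LKK[of x] by (simp add: KK le)
      then show ?thesis by (metis (no_types) minus_diff_eq minus_minus uminus_add_conv_diff scaleR_minus_left)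
    qed
    define \<mu> where "\<mu> = (2 * g N z - g (L N) z) / g N z"
    have \<mu>: "L N = \<mu> *\<^sub>R N"
      using rel[of z] z unfolding \<mu>_def
      by (simp add: eq_vector_fraction_iff algebra_simps)
    have "g N z * \<mu> = - \<mu> * g N z + 2 * g N z"
      using rel[of z] N0 unfolding \<mu> by (simp add: expand flip: scaleR_add_left scaleR_left.diff)
    then have "\<mu> = 1" using z by (simp add: algebra_simps)
    then show ?thesis using \<mu> by simp
  qed
  obtain M where M: "L M = - M" and NM: "g N N = 0" "g M M = 0" "g N M = - 2"
    by (rule opposite_eigenvector[OF L LN N0])
  have MN: "g M N = - 2" using NM(3) sym[of M N] by simp
  define W where "W = {x. g N x = 0 \<and> g M x = 0}"
  note W = null_pair_complement[OF NM, folded W_def]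
  define h where "h = (1/2) *\<^sub>R K M"
  have KM: "K M = 2 *\<^sub>R h" by (simp add: h_def)
  have Kh: "K h = N" using NM by (simp add: h_def le KK)
  \<comment> \<open>The commutator at \<open>M\<close>, where \<open>L M = - M\<close>, leaves
    \<open>L (K M) = 0\<close>.\<close>
  have Lh: "L h = 0" using comm[of M] M by (simp add: h_def le)
  have h1: "g N h = 0" using skK[of N M] KN by (simp add: h_def expand)
  have h2: "g M h = 0" using skew_self[OF K, of M] by (simp add: h_def expand)
  have hh: "g h h = 1" using skK[of M h] KM Kh MN by (simp add: expand)
  have h: "h \<in> W" using h1 h2 by (simp add: W_def)
  have h': "g h N = 0" "g h M = 0" using h1 h2 sym by auto
  define V where "V = {x \<in> W. g h x = 0}"
  have V: "subspace V" unfolding V_def by (rule subspace_bilinear_orthogonal[OF bilinear W(1)])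
  have posV: "g x x > 0" if "x \<in> V" "x \<noteq> 0" for x using that W(3) by (simp add: V_def)
  have "dim V + 1 = dim W"
    unfolding V_def by (rule dim_bilinear_orthogonal[OF bilinear W(1) h]) (simp add: hh)
  then have d: "n = Suc (Suc (dim V))" using W(2) n by simp
  have LV: "L x \<in> V" if "x \<in> V" for x
    using that skL[of N x] skL[of M x] skL[of h x] LN M Lh by (simp add: V_def W_def expand)
  \<comment> \<open>\<open>K x\<close> is null, because \<open>g N x = 0\<close> kills the square of
    \<open>K\<close> at \<open>x\<close>, and it lies in the definite space
    \<open>W\<close>.\<close>
  have KV: "K x = 0" if x: "x \<in> V" for x
  proof -
    have "g N (K x) = 0" "g M (K x) = 0"
      using skK[of N x] skK[of M x] KN KM x by (simp_all add: V_def expand)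
    then have "K x \<in> W" by (simp add: W_def)
    moreover have "g (K x) (K x) = 0"
      using skK[of x "K x"] x sym[of x N] by (simp add: KK expand V_def W_def)
    ultimately show ?thesis using W(3) by force
  qed
  have decomp: "\<exists>\<alpha> \<beta> \<gamma> v. v \<in> V \<and> x = \<alpha> *\<^sub>R N + \<beta> *\<^sub>R M + \<gamma> *\<^sub>R h + v" for x
  proof -
    let ?v = "x - (- g M x / 2) *\<^sub>R N - (- g N x / 2) *\<^sub>R M - g h x *\<^sub>R h"
    have "?v \<in> V" using NM MN h1 h2 hh h' by (simp add: V_def W_def expand)
    then show ?thesis
      by (intro exI[of _ "- g M x / 2"] exI[of _ "- g N x / 2"] exI[of _ "g h x"] exI[of _ ?v]) simp
  qed
  obtain \<alpha> \<beta> \<gamma> w where w: "w \<in> V" and l: "l = \<alpha> *\<^sub>R N + \<beta> *\<^sub>R M + \<gamma> *\<^sub>R h + w"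
    using decomp by blast
  obtain p u r b q where p: "p \<in> V" and u: "skew_frame g L V u r b"
    and q: "L p + w = q *\<^sub>R u (dim V - 1)" "dim V = 0 \<longrightarrow> q = 0"
    by (rule skew_affine_frame[OF bilinear sym lin(1) V posV LV skL w])
  define p1 where "p1 = p - \<alpha> *\<^sub>R N + \<beta> *\<^sub>R M"
  let ?w = "L p + w"
  have w': "?w \<in> V" using p w LV V by (simp add: subspace_add)
  have l1: "L p1 + l = \<gamma> *\<^sub>R h + ?w" by (simp add: p1_def l le LN M)
  define k1 where "k1 = K p1 + k"
  \<comment> \<open>The bracket relation between the constant parts persists after moving the origin
    to \<open>p1\<close>.\<close>
  have "L k1 - K (L p1 + l) = k1"
    using lk comm[of p1] by (simp add: k1_def le algebra_simps)
  then have k1: "L k1 - \<gamma> *\<^sub>R N = k1"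
    unfolding l1 using KV[OF w'] by (simp add: le Kh)
  obtain a c t v where v: "v \<in> V" and k: "k1 = a *\<^sub>R N + c *\<^sub>R M + t *\<^sub>R h + v"
    using decomp by blast
  have Lv: "g N (L v) = 0" "g M (L v) = 0" "g h (L v) = 0" "g N v = 0" "g M v = 0" "g h v = 0"
    using LV[OF v] v by (simp_all add: V_def W_def)
  have "g x (L k1 - \<gamma> *\<^sub>R N) = g x k1" for x using k1 by simp
  \<comment> \<open>Pairing with \<open>M\<close>, \<open>N\<close> and \<open>h\<close> reads off
    the coefficients of \<open>N\<close>, \<open>M\<close> and \<open>h\<close>, in this
    order.\<close>
  from this[of M] this[of N] this[of h] have \<gamma>: "\<gamma> = 0" and c: "c = 0" and t: "t = 0"
    unfolding k using Lv NM MN h1 h2 hh h' by (simp_all add: le expand LN M Lh)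
  have "L v = v" using k1 unfolding k \<gamma> c t by (simp add: le LN)
  then have "g v v = 0" using skew_self[OF L, of v] by simp
  then have v0: "v = 0" using posV[OF v] by force
  define f where "f = case_nat ((1/2) *\<^sub>R (N + M)) (case_nat h (case_nat ((1/2) *\<^sub>R (N - M)) u))"
  have f: "f 0 = (1/2) *\<^sub>R (N + M)" "f (Suc 0) = h" "f (Suc (Suc 0)) = (1/2) *\<^sub>R (N - M)"
    "f (Suc (Suc (Suc i))) = u i" for i
    by (simp_all add: f_def)
  have f2: "f 2 = (1/2) *\<^sub>R (N - M)" by (simp add: f eval_nat_numeral)
  have uV: "u i \<in> V" if "i < dim V" for i using u that by (simp add: skew_frame_def)
  have o: "g N (u i) = 0" "g (u i) N = 0" "g M (u i) = 0" "g (u i) M = 0" "g h (u i) = 0" "g (u i) h = 0"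
    if "i < dim V" for i
    using uV[OF that] sym[of "u i"] by (simp_all add: V_def W_def)
  show ?thesis
  proof (intro exI conjI)
    show "lorentz_frame f n"
      unfolding lorentz_frame_def
    proof (intro allI impI)
      fix i j assume "i \<le> n" "j \<le> n"
      then show "g (f i) (f j) = (if i = j then if i = 0 then - 1 else 1 else 0)"
        using u o NM MN h1 h2 hh h' unfolding d skew_frame_def f_def
        by (auto simp: expand split: nat.split)
    qed
    show "2 * r + 2 \<le> n" using u d by (simp add: skew_frame_def)
    \<comment> \<open>What remains of \<open>k1\<close> is \<open>a\<close> times \<open>N\<close>.
      Since \<open>K h = N\<close> and \<open>L h = 0\<close>, a shift along \<open>h\<close>
      removes it without disturbing \<open>l\<close>.\<close>
    have "K (p1 - a *\<^sub>R h) + k = k1 - a *\<^sub>R N" by (simp add: k1_def le Kh)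
    then show "K (p1 - a *\<^sub>R h) + k = 0" by (simp add: k c t v0)
    have "L (p1 - a *\<^sub>R h) + l = ?w" using l1 by (simp add: le Lh \<gamma>)
    also have "\<dots> = q *\<^sub>R f n" using q d by (cases "dim V") (simp_all add: f)
    finally show "L (p1 - a *\<^sub>R h) + l = q *\<^sub>R f n" .
    show "K (f 0) = f 1" "K (f 1) = f 0 + f 2" "K (f 2) = - f 1"
      by (simp_all add: f f2 le KN KM Kh algebra_simps flip: scaleR_add_left)
    show "L (f 0) = f 2" "L (f 1) = 0" "L (f 2) = f 0"
      by (simp_all add: f f2 le LN M Lh)
    show "\<forall>i<r. L (f (2*i+3)) = b i *\<^sub>R f (2*i+4) \<and> L (f (2*i+4)) = - b i *\<^sub>R f (2*i+3)"
      using u by (simp add: skew_frame_def f eval_nat_numeral)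
    show "\<forall>i\<le>n. 3 \<le> i \<longrightarrow> K (f i) = 0"
      using KV uV unfolding d f_def by (auto split: nat.split)
    show "\<forall>i\<le>n. 2*r+3 \<le> i \<longrightarrow> L (f i) = 0"
      using u unfolding d skew_frame_def f_def by (auto split: nat.split)
  qed
qed

end

subsection \<open>Killing fields of Minkowski spacetime\<close>

lemma smooth_has_derivative:
  assumes "smooth f"
  shows "(f has_derivative frechet_derivative f (at x)) (at x)"
proof -
  have "times_cont_diff (Suc 0) f" using assms by (simp add: smooth_def del: times_cont_diff.simps)
  then show ?thesis by (simp add: differentiable_on_def frechet_derivative_works)
qed

text \<open>The Killing equation makes the Jacobian antisymmetric, so its quadratic form vanishes in
  every direction, as needed for differentiating along lines.\<close>

lemma killing_derivative_skew:
  fixes \<xi> :: "real ^ 'm::finite \<Rightarrow> real ^ 'm"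
  assumes "killing_field \<xi>"
  shows "frechet_derivative \<xi> (at x) v \<bullet> v = 0"
proof -
  let ?D = "frechet_derivative \<xi> (at x)"
  have D: "(\<xi> has_derivative ?D) (at x)"
    using assms by (simp add: killing_field_def smooth_has_derivative)
  then have lin: "linear ?D" by (rule has_derivative_linear)
  have "partial_deriv \<mu> (\<lambda>y. \<xi> y $ \<nu>) x = ?D (axis \<mu> 1) $ \<nu>" for \<mu> \<nu>
  proof -
    have "((\<lambda>y. \<xi> y $ \<nu>) has_derivative (\<lambda>h. ?D h $ \<nu>)) (at x)"
      by (rule bounded_linear.has_derivative[OF bounded_linear_vec_nth D])
    then show ?thesis unfolding partial_deriv_def by (simp flip: frechet_derivative_at)
  qed
  then have "?D (axis \<mu> 1) $ \<nu> + ?D (axis \<nu> 1) $ \<mu> = 0" for \<mu> \<nu>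
    using assms unfolding killing_field_def by metis
  then have "transpose (matrix ?D) = - matrix ?D"
    by (simp add: matrix_def transpose_def vec_eq_iff eq_neg_iff_add_eq_0)
  then have "v \<bullet> (matrix ?D *v v) = - ((matrix ?D *v v) \<bullet> v)"
    using dot_lmul_matrix[of v "matrix ?D" v]
    by (simp add: matrix_vector_mult_def sum_negf inner_vec_def flip: transpose_matrix_vector)
  then show ?thesis using lin by (simp add: matrix_works inner_commute)
qed

text \<open>The component of \<open>\<xi>\<close> along a line is constant on that line, so \<open>f x = \<xi> x - \<xi> 0\<close>
  satisfies \<open>f x \<bullet> y = - f y \<bullet> x\<close>, and the right-hand side is linear in \<open>x\<close>.\<close>

lemma killing_field_affine:
  fixes \<xi> :: "real ^ 'm::finite \<Rightarrow> real ^ 'm"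
  assumes "killing_field \<xi>"
  obtains A where "linear A" "\<And>x y. A x \<bullet> y = - (x \<bullet> A y)" "\<And>x. \<xi> x = A x + \<xi> 0"
proof -
  let ?D = "\<lambda>x. frechet_derivative \<xi> (at x)"
  have D: "(\<xi> has_derivative ?D x) (at x)" for x
    using assms by (simp add: killing_field_def smooth_has_derivative)
  have line: "\<xi> x \<bullet> (x - y) = \<xi> y \<bullet> (x - y)" for x y
  proof -
    let ?\<gamma> = "\<lambda>t. y + t *\<^sub>R (x - y)"
    have "((\<lambda>t. \<xi> (?\<gamma> t) \<bullet> (x - y)) has_derivative (\<lambda>h. 0)) (at t)" for t
    proof -
      have "(?\<gamma> has_derivative (\<lambda>h. h *\<^sub>R (x - y))) (at t)"
        by (auto intro!: derivative_eq_intros)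
      then have "((\<lambda>t. \<xi> (?\<gamma> t)) has_derivative (\<lambda>h. ?D (?\<gamma> t) (h *\<^sub>R (x - y)))) (at t)"
        using diff_chain_at[OF _ D, of ?\<gamma>] by (fastforce simp: o_def)
      then have "((\<lambda>t. \<xi> (?\<gamma> t) \<bullet> (x - y)) has_derivative
          (\<lambda>h. ?D (?\<gamma> t) (h *\<^sub>R (x - y)) \<bullet> (x - y))) (at t)"
        by (rule has_derivative_inner_left)
      moreover have "?D (?\<gamma> t) (h *\<^sub>R (x - y)) \<bullet> (x - y) = 0" for h
        using killing_derivative_skew[OF assms] has_derivative_linear[OF D]
        by (simp add: linear_scale)
      ultimately show ?thesis by simp
    qed
    then have "\<exists>c. \<forall>t\<in>UNIV. \<xi> (?\<gamma> t) \<bullet> (x - y) = c"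
      by (intro has_derivative_zero_constant) auto
    then have "\<xi> (?\<gamma> 1) \<bullet> (x - y) = \<xi> (?\<gamma> 0) \<bullet> (x - y)" by (metis UNIV_I)
    then show ?thesis by simp
  qed
  define A where "A x = \<xi> x - \<xi> 0" for x
  have self: "A x \<bullet> x = 0" for x using line[of x 0] by (simp add: A_def inner_diff_left)
  have skew: "A x \<bullet> y = - (x \<bullet> A y)" for x y
  proof -
    \<comment> \<open>Once \<open>self\<close> removes the diagonal terms, the identity on the line
      through \<open>x\<close> and \<open>y\<close> polarises to skewness.\<close>
    have "(A x - A y) \<bullet> (x - y) = 0" using line[of x y] by (simp add: A_def inner_diff_left)
    then show ?thesis using self[of x] self[of y]
      by (simp add: inner_diff_left inner_diff_right inner_commute)
  qed
  have "linear A"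
  proof (rule linearI)
    show "A (x + y) = A x + A y" for x y
      by (subst vector_eq_rdot[symmetric]) (simp add: skew inner_add_left)
    show "A (c *\<^sub>R x) = c *\<^sub>R A x" for c x
      by (subst vector_eq_rdot[symmetric]) (simp add: skew)
  qed
  then show thesis using skew that by (simp add: A_def)
qed

lemma partial_deriv_affine:
  assumes "linear K"
  shows "partial_deriv \<nu> (\<lambda>y. (K y + k) $ \<mu>) x = K (axis \<nu> 1) $ \<mu>"
proof -
  have "bounded_linear K" using assms linear_conv_bounded_linear by blast
  then have "((\<lambda>y. K y + k) has_derivative (\<lambda>h. K h)) (at x)"
    by (auto intro!: derivative_eq_intros bounded_linear_imp_has_derivative)
  then have "((\<lambda>y. (K y + k) $ \<mu>) has_derivative (\<lambda>h. K h $ \<mu>)) (at x)"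
    by (rule bounded_linear.has_derivative[OF bounded_linear_vec_nth])
  then show ?thesis unfolding partial_deriv_def by (simp flip: frechet_derivative_at)
qed

text \<open>The derivative of the second field along the first is \<open>L\<close> applied to the
  first, so the linear parts enter as the commutator of \<open>L\<close> with \<open>K\<close>, in
  reversed order.\<close>

lemma lie_bracket_affine:
  assumes "linear K" "linear L"
  shows "lie_bracket (\<lambda>x. K x + k) (\<lambda>x. L x + l) x = L (K x + k) - K (L x + l)"
  unfolding lie_bracket_def
  by (simp add: vec_eq_iff partial_deriv_affine[OF assms(1)] partial_deriv_affine[OF assms(2)]
      sum_subtractf linear_componentwise[OF assms(1)[folded linear_matrix_vector_mul_eq], of "L x + l"] linear_componentwise[OF assms(2)[folded linear_matrix_vector_mul_eq], of "K x + k"]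
      del: vector_add_component)

section \<open>The Minkowski metric as a matrix and as a Lorentzian form\<close>

lemma minkowski_metric_mult:
  "(minkowski_metric e *v x) $ \<mu> = (if \<mu> = e 0 then - x $ \<mu> else x $ \<mu>)"
  by (simp add: minkowski_metric_def matrix_vector_mult_def if_distrib[of "\<lambda>t. t * _"] cong: if_cong)

lemma minkowski_metric_involution [simp]:
  "minkowski_metric e *v (minkowski_metric e *v x) = x"
  by (simp add: vec_eq_iff minkowski_metric_mult)

lemma minkowski_metric_square: "minkowski_metric e ** minkowski_metric e = mat 1"
  by (simp add: matrix_eq flip: matrix_vector_mul_assoc)

lemma matrix_inv_eq:
  fixes A B :: "real ^ 'n ^ 'n"
  assumes "A ** B = mat 1"
  shows "matrix_inv A = B"
proof -
  have "B ** A = mat 1" using assms by (simp add: matrix_left_right_inverse)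
  then have "A ** matrix_inv A = mat 1 \<and> matrix_inv A ** A = mat 1"
    unfolding matrix_inv_def
    by (intro someI[of "\<lambda>X. A ** X = mat 1 \<and> X ** A = mat 1" B] conjI assms)
  then have "matrix_inv A ** (A ** B) = B" unfolding matrix_mul_assoc by simp
  then show ?thesis using assms by simp
qed

lemma matrix_inv_minkowski_metric: "matrix_inv (minkowski_metric e) = minkowski_metric e"
  by (rule matrix_inv_eq[OF minkowski_metric_square])

definition minkowski_form :: "(nat \<Rightarrow> 'm::finite) \<Rightarrow> real ^ 'm \<Rightarrow> real ^ 'm \<Rightarrow> real"
  where "minkowski_form e x y = x \<bullet> (minkowski_metric e *v y)"

lemma minkowski_metric_mult_eq: "minkowski_metric e *v x = x - (2 * x $ e 0) *\<^sub>R axis (e 0) 1"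
  by (auto simp: vec_eq_iff minkowski_metric_mult axis_def)

lemma minkowski_form_eq: "minkowski_form e x y = x \<bullet> y - 2 * x $ e 0 * y $ e 0"
  by (simp add: minkowski_form_def minkowski_metric_mult_eq inner_diff_right inner_axis)

lemma inner_minkowski_metric: "(minkowski_metric e *v x) \<bullet> y = x \<bullet> (minkowski_metric e *v y)"
  by (simp add: minkowski_metric_mult_eq inner_diff_right inner_diff_left inner_axis inner_axis')

text \<open>Cauchy-Schwarz for the spatial parts.\<close>

lemma minkowski_orthogonal_timelike:
  assumes "minkowski_form e v v < 0" "minkowski_form e v x = 0" "x \<noteq> 0"
  shows "minkowski_form e x x > 0"
proof -
  \<comment> \<open>Projection onto the spatial part.\<close>
  let ?s = "\<lambda>y. y - y $ e 0 *\<^sub>R axis (e 0) 1"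
  have s: "?s y \<bullet> ?s z = y \<bullet> z - y $ e 0 * z $ e 0" for y z
    by (simp add: inner_diff_left inner_diff_right inner_axis inner_axis' inner_axis_axis)
  let ?a = "v $ e 0" and ?b = "x $ e 0"
  have v: "?s v \<bullet> ?s v < ?a\<^sup>2" and vx: "?s v \<bullet> ?s x = ?a * ?b"
    using assms unfolding s by (auto simp: minkowski_form_eq power2_eq_square)
  have a: "?a \<noteq> 0" using v inner_ge_zero[of "?s v"] by (auto simp del: inner_ge_zero)
  have x: "?s x \<noteq> 0"
  proof
    assume 0: "?s x = 0"
    then have "?a * ?b = 0" using vx by simp
    then show False using 0 a assms(3) by simp
  qed
  have "?a\<^sup>2 * ?b\<^sup>2 \<le> (?s v \<bullet> ?s v) * (?s x \<bullet> ?s x)"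
    using Cauchy_Schwarz_ineq[of "?s v" "?s x"] unfolding vx by (simp add: power_mult_distrib)
  also have "\<dots> < ?a\<^sup>2 * (?s x \<bullet> ?s x)"
    using v x by (intro mult_strict_right_mono) auto
  finally have "?b\<^sup>2 < ?s x \<bullet> ?s x" using a by simp
  then show ?thesis unfolding s by (simp add: minkowski_form_eq power2_eq_square)
qed

lemma lorentzian_minkowski_form: "lorentzian_form (minkowski_form e)"
proof
  show "bilinear (minkowski_form e)"
    unfolding bilinear_def
    by (auto intro!: linearI simp: minkowski_form_eq algebra_simps inner_add_left inner_add_right)
  show "minkowski_form e x y = minkowski_form e y x" for x y
    by (simp add: minkowski_form_eq inner_commute)
  show "\<exists>v. minkowski_form e v v < 0"
    by (intro exI[of _ "axis (e 0) 1"]) (simp add: minkowski_form_eq inner_axis_axis)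
qed (rule minkowski_orthogonal_timelike)

section \<open>From Lorentz frames to Poincare transformations\<close>

text \<open>Splits the coordinates into the boost block, the \<open>r\<close> rotation planes and
  the kernel. The block has \<open>t + 2\<close> members, with \<open>t = 0\<close> for a
  translation and \<open>t = 1\<close> for a null rotation, so plane \<open>i\<close> starts at
  \<open>2*i+t\<close>.\<close>

lemma sum_pairs:
  fixes h :: "nat \<Rightarrow> 'a::comm_monoid_add"
  assumes "t + 2 + 2 * r \<le> n + 1" "\<And>i. i \<le> n \<Longrightarrow> t + 2 + 2 * r \<le> i \<Longrightarrow> h i = 0"
  shows "(\<Sum>i=0..n. h i) = (\<Sum>i<t+2. h i) + (\<Sum>i=1..r. h (2*i+t) + h (2*i+t+1))"
proof -
  have "(\<Sum>i=0..n. h i) = (\<Sum>i<t+2+2*r. h i)"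
    using assms by (intro sum.mono_neutral_right) auto
  also have "\<dots> = (\<Sum>i<t+2. h i) + (\<Sum>i=1..r. h (2*i+t) + h (2*i+t+1))"
    by (induction r) (simp_all add: ac_simps)
  finally show ?thesis .
qed

text \<open>The frame gives the columns of \<open>P = \<Lambda>\<^sup>-\<^sup>1\<close>, and \<open>p = - \<Lambda>\<^sup>-\<^sup>1 c\<close>.\<close>

lemma lorentz_frame_transformation:
  fixes e :: "nat \<Rightarrow> 'm::finite"
  assumes e: "bij_betw e {0..n} UNIV"
    and f: "lorentzian_form.lorentz_frame (minkowski_form e) f n"
  obtains \<Lambda> c P where "\<Lambda> \<in> lorentz_group e"
    "\<And>i. i \<le> n \<Longrightarrow> P *v (minkowski_metric e *v dcrd e i) = (if i = 0 then - f i else f i)"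
    "\<And>x. P *v x = (\<Sum>i=0..n. crd e i x *\<^sub>R f i)"
    "\<And>\<xi> x R. \<xi> (P *v x + p) = minkowski_metric e *v (P *v (minkowski_metric e *v R))
      \<Longrightarrow> transform_form \<Lambda> c \<xi> x = R"
proof -
  interpret lorentzian_form "minkowski_form e" by (rule lorentzian_minkowski_form)
  let ?J = "minkowski_metric e"
  define P :: "real^'m^'m" where "P = (\<chi> \<mu> \<nu>. f (inv_into {0..n} e \<nu>) $ \<mu>)"
  have inj: "inj_on e {0..n}" using e by (rule bij_betw_imp_inj_on)
  have col: "P *v axis (e i) 1 = f i" if "i \<le> n" for i
    using that inj by (simp add: matrix_vector_mult_basis column_def P_def vec_eq_iff)
  have PJP: "transpose P ** ?J ** P = ?J"
  proof -
    have "(transpose P ** ?J ** P) $ \<mu> $ \<nu> = ?J $ \<mu> $ \<nu>" for \<mu> \<nu>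
    proof -
      obtain i j where ij: "i \<le> n" "j \<le> n" "\<mu> = e i" "\<nu> = e j"
      proof -
        have "\<mu> \<in> e ` {0..n}" "\<nu> \<in> e ` {0..n}" using e by (simp_all add: bij_betw_def)
        then show thesis using that by auto
      qed
      have "(transpose P ** ?J ** P) $ \<mu> $ \<nu> = axis \<mu> 1 \<bullet> ((transpose P ** ?J ** P) *v axis \<nu> 1)"
        by (simp add: inner_axis' matrix_vector_mult_basis column_def)
      also have "\<dots> = minkowski_form e (P *v axis \<mu> 1) (P *v axis \<nu> 1)"
        unfolding minkowski_form_def matrix_vector_mul_assoc[symmetric]
        by (metis dot_lmul_matrix transpose_matrix_vector transpose_transpose)
      also have "\<dots> = (if i = j then if i = 0 then - 1 else 1 else 0)"
        using f ij by (simp add: col lorentz_frame_def)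
      also have "\<dots> = ?J $ \<mu> $ \<nu>"
        using ij inj_on_eq_iff[OF inj, of i j] inj_on_eq_iff[OF inj, of i 0] inj_on_eq_iff[OF inj, of j 0]
        by (simp add: minkowski_metric_def)
      finally show ?thesis .
    qed
    then show ?thesis by (simp add: vec_eq_iff)
  qed
  \<comment> \<open>The inverse of \<open>P\<close>, read off from \<open>PJP\<close>.\<close>
  define \<Lambda> where "\<Lambda> = ?J ** transpose P ** ?J"
  have \<Lambda>P: "\<Lambda> ** P = mat 1"
    unfolding \<Lambda>_def using PJP minkowski_metric_square by (metis matrix_mul_assoc)
  then have P\<Lambda>: "P ** \<Lambda> = mat 1" by (simp add: matrix_left_right_inverse)
  have "transpose \<Lambda> ** ?J ** \<Lambda> = transpose \<Lambda> ** (transpose P ** ?J ** P) ** \<Lambda>" by (simp only: PJP)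
  also have "\<dots> = transpose (P ** \<Lambda>) ** ?J ** (P ** \<Lambda>)"
    by (simp only: matrix_transpose_mul matrix_mul_assoc)
  also have "\<dots> = ?J" by (simp add: P\<Lambda> transpose_mat)
  finally have "\<Lambda> \<in> lorentz_group e" by (simp add: lorentz_group_def)
  moreover have "P *v (?J *v dcrd e i) = (if i = 0 then - f i else f i)" if "i \<le> n" for i
  proof -
    have "?J *v dcrd e i = (if i = 0 then - dcrd e i else dcrd e i)"
      using that inj_on_eq_iff[OF inj, of i 0]
      by (auto simp: vec_eq_iff minkowski_metric_mult dcrd_def axis_def)
    then show ?thesis
      using col[OF that] by (auto simp: dcrd_def linear_neg[OF matrix_vector_mul_linear])
  qed
  moreover have "P *v x = (\<Sum>i=0..n. crd e i x *\<^sub>R f i)" for x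
  proof -
    have "P *v x = (\<Sum>\<nu>\<in>UNIV. x $ \<nu> *\<^sub>R (P *v axis \<nu> 1))"
      unfolding matrix_vector_mult_basis by (simp add: matrix_mult_sum scalar_mult_eq_scaleR)
    also have "\<dots> = (\<Sum>i=0..n. x $ e i *\<^sub>R (P *v axis (e i) 1))"
      by (rule sum.reindex_bij_betw[OF e, symmetric])
    finally show ?thesis by (simp add: crd_def col)
  qed
  \<comment> \<open>The hypothesis says that raising the index of \<open>R\<close>, mapping back by
    \<open>P\<close> and lowering the index again gives the original form.\<close>
  moreover have "transform_form \<Lambda> (- (\<Lambda> *v p)) \<xi> x = R"
    if "\<xi> (P *v x + p) = ?J *v (P *v (?J *v R))" for \<xi> x R
  proof -
    have "transform_form \<Lambda> (- (\<Lambda> *v p)) \<xi> x = transpose P *v \<xi> (P *v x + p)"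
      using P\<Lambda> by (simp add: transform_form_def matrix_inv_eq[OF \<Lambda>P] matrix_vector_right_distrib
          matrix_vector_mul_assoc)
    also have "\<dots> = (transpose P ** ?J ** P) *v (?J *v R)"
      unfolding that by (simp add: matrix_vector_mul_assoc matrix_mul_assoc)
    finally show ?thesis by (simp add: PJP)
  qed
  ultimately show thesis by (rule that)
qed

theorem theorem4:
  fixes n :: nat
    and e :: "nat \<Rightarrow> 'm::finite"
    and \<xi> \<eta> :: "real ^ 'm \<Rightarrow> real ^ 'm"
  assumes "n \<ge> 1"
    and "bij_betw e {0..n} UNIV"
    and "killing_field \<xi>" and "killing_field \<eta>"
    and "\<xi> \<noteq> (\<lambda>x. 0)"
    and "lie_bracket (sharp e \<xi>) (sharp e \<eta>) = sharp e \<xi>"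
  shows "\<exists>\<Lambda> c. \<Lambda> \<in> lorentz_group e \<and>
    (\<exists>(r::nat) (b :: nat \<Rightarrow> real) (q::real).
      (n \<ge> 2 \<and> 2 * r + 2 \<le> n \<and>
       transform_form \<Lambda> c \<xi> =
         (\<lambda>x. (crd e 0 x - crd e 2 x) *\<^sub>R dcrd e 1 - crd e 1 x *\<^sub>R (dcrd e 0 - dcrd e 2)) \<and>
       transform_form \<Lambda> c \<eta> =
         (\<lambda>x. crd e 0 x *\<^sub>R dcrd e 2 - crd e 2 x *\<^sub>R dcrd e 0
            + (\<Sum>i=1..r. b (2*i+1) *\<^sub>R
                 (crd e (2*i+1) x *\<^sub>R dcrd e (2*i+2) - crd e (2*i+2) x *\<^sub>R dcrd e (2*i+1)))
            + q *\<^sub>R dcrd e n))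
      \<or>
      (2 * r + 1 \<le> n \<and>
       transform_form \<Lambda> c \<xi> = (\<lambda>x. - dcrd e 0 + dcrd e 1) \<and>
       transform_form \<Lambda> c \<eta> =
         (\<lambda>x. crd e 0 x *\<^sub>R dcrd e 1 - crd e 1 x *\<^sub>R dcrd e 0
            + (\<Sum>i=1..r. b (2*i) *\<^sub>R
                 (crd e (2*i) x *\<^sub>R dcrd e (2*i+1) - crd e (2*i+1) x *\<^sub>R dcrd e (2*i)))
            + q *\<^sub>R dcrd e n)))"
proof -
  interpret lorentzian_form "minkowski_form e" by (rule lorentzian_minkowski_form)
  let ?J = "minkowski_metric e"
  have DIM: "DIM(real ^ 'm) = n + 1" using bij_betw_same_card[OF assms(2)] by simp
  \<comment> \<open>The metric matrix is a symmetric involution, so Euclidean skewness of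
    \<open>A\<close> is skewness of the raised map for the Minkowski form.\<close>
  have raise: "\<exists>K k. skew K \<and> (\<forall>x. \<zeta> x = ?J *v (K x + k)) \<and> sharp e \<zeta> = (\<lambda>x. K x + k)"
    if \<zeta>: "killing_field \<zeta>" for \<zeta>
  proof -
    obtain A where A: "linear A" "\<And>x y. A x \<bullet> y = - (x \<bullet> A y)" "\<And>x. \<zeta> x = A x + \<zeta> 0"
      using killing_field_affine[OF \<zeta>] by blast
    have "sharp e \<zeta> = (\<lambda>x. ?J *v A x + ?J *v \<zeta> 0)"
      unfolding sharp_def matrix_inv_minkowski_metric by (subst A(3)) (simp add: matrix_vector_right_distrib)
    moreover have "skew (\<lambda>x. ?J *v A x)"
      unfolding skew_def
      using A(2) linear_compose[OF A(1) matrix_vector_mul_linear[of ?J]]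
      by (simp add: minkowski_form_def inner_minkowski_metric o_def)
    moreover have "\<zeta> x = ?J *v (?J *v A x + ?J *v \<zeta> 0)" for x
      by (subst A(3)) (simp add: matrix_vector_right_distrib)
    ultimately show ?thesis by blast
  qed
  obtain K k where K: "skew K" and \<xi>: "\<And>x. \<xi> x = ?J *v (K x + k)" and "sharp e \<xi> = (\<lambda>x. K x + k)"
    using raise[OF assms(3)] by blast
  obtain L l where L: "skew L" and \<eta>: "\<And>x. \<eta> x = ?J *v (L x + l)" and "sharp e \<eta> = (\<lambda>x. L x + l)"
    using raise[OF assms(4)] by blast
  note linK = skew_linear[OF K] and linL = skew_linear[OF L]
  have brk: "L (K x + k) - K (L x + l) = K x + k" for x
    using fun_cong[OF assms(6), of x] \<open>sharp e \<xi> = _\<close> \<open>sharp e \<eta> = _\<close>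
    by (simp add: lie_bracket_affine[OF linK linL])
  have lk: "L k - K l = k" using brk[of 0] by (simp add: linear_0[OF linK] linear_0[OF linL])
  have comm: "L (K x) - K (L x) = K x" for x
    using brk[of x] lk by (simp add: linear_add[OF linK] linear_add[OF linL] algebra_simps)
  show ?thesis
  proof (cases "\<exists>x. K x \<noteq> 0")
    case True
    then obtain x0 where "K x0 \<noteq> 0" by blast
    from null_rotation_frame[OF L K comm this lk DIM]
    obtain p f r b q where f: "lorentz_frame f n" and r: "2 * r + 2 \<le> n"
      and Kp: "K p + k = 0" and Lp: "L p + l = q *\<^sub>R f n"
      and Kf: "K (f 0) = f 1" "K (f 1) = f 0 + f 2" "K (f 2) = - f 1" "\<And>i. i \<le> n \<Longrightarrow> 3 \<le> i \<Longrightarrow> K (f i) = 0"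
      and Lf: "L (f 0) = f 2" "L (f 1) = 0" "L (f 2) = f 0"
      and Lb: "\<And>i. i < r \<Longrightarrow> L (f (2*i+3)) = b i *\<^sub>R f (2*i+4)"
        "\<And>i. i < r \<Longrightarrow> L (f (2*i+4)) = - b i *\<^sub>R f (2*i+3)"
      and L0: "\<And>i. i \<le> n \<Longrightarrow> 2*r+3 \<le> i \<Longrightarrow> L (f i) = 0"
      by blast
    \<comment> \<open>The frame counts planes from 0, whereas the target sum starts at
      \<open>i = 1\<close> and labels constants by coordinate index; both \<open>2*i\<close> and
      \<open>2*i+1\<close> are sent to \<open>i - 1\<close>.\<close>
    define b' where "b' j = b (j div 2 - 1)" for j
    have Lb': "L (f (2*i+1)) = b' (2*i+1) *\<^sub>R f (2*i+2)" "L (f (2*i+2)) = - b' (2*i+1) *\<^sub>R f (2*i+1)"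
      if "i \<in> {1..r}" for i
    proof -
      define j where "j = i - 1"
      have "2*i+1 = 2*j+3" "2*i+2 = 2*j+4" "j < r" "b' (2*i+1) = b j"
        using that by (auto simp: j_def b'_def)
      then show "L (f (2*i+1)) = b' (2*i+1) *\<^sub>R f (2*i+2)" "L (f (2*i+2)) = - b' (2*i+1) *\<^sub>R f (2*i+1)"
        using Lb[of j] by (simp_all only:)
    qed
    obtain \<Lambda> c P where \<Lambda>: "\<Lambda> \<in> lorentz_group e"
      and Pd: "\<And>i. i \<le> n \<Longrightarrow> P *v (?J *v dcrd e i) = (if i = 0 then - f i else f i)"
      and P: "\<And>x. P *v x = (\<Sum>i=0..n. crd e i x *\<^sub>R f i)"
      and tr: "\<And>\<zeta> x R. \<zeta> (P *v x + p) = ?J *v (P *v (?J *v R)) \<Longrightarrow> transform_form \<Lambda> c \<zeta> x = R"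
      by (rule lorentz_frame_transformation[OF assms(2) f, of p]) (rule that)
    note pj = matrix_vector_right_distrib matrix_vector_mult_diff_distrib matrix_vector_mult_scaleR
      linear_sum[OF matrix_vector_mul_linear]
    have "transform_form \<Lambda> c \<xi> x =
        (crd e 0 x - crd e 2 x) *\<^sub>R dcrd e 1 - crd e 1 x *\<^sub>R (dcrd e 0 - dcrd e 2)" for x
    proof (rule tr)
      have "K (P *v x + p) + k = (\<Sum>i=0..n. crd e i x *\<^sub>R K (f i))"
        using Kp by (simp add: linear_add[OF linK] add.assoc P linear_sum[OF linK] linear_scale[OF linK])
      also have "\<dots> = (\<Sum>i<3. crd e i x *\<^sub>R K (f i))"
        using sum_pairs[of 1 0 n "\<lambda>i. crd e i x *\<^sub>R K (f i)"] Kf(4) r by (simp add: eval_nat_numeral)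
      \<comment> \<open>Raising the time index turns \<open>dcrd e 0\<close> into
        \<open>- f 0\<close>, which accounts for the sign difference between the forms and the
        vectors.\<close>
      also have "\<dots> = P *v (?J *v ((crd e 0 x - crd e 2 x) *\<^sub>R dcrd e 1 - crd e 1 x *\<^sub>R (dcrd e 0 - dcrd e 2)))"
        using r Kf by (simp add: pj Pd eval_nat_numeral algebra_simps)
      finally show "\<xi> (P *v x + p) = ?J *v \<dots>" by (simp add: \<xi>)
    qed
    moreover have "transform_form \<Lambda> c \<eta> x = crd e 0 x *\<^sub>R dcrd e 2 - crd e 2 x *\<^sub>R dcrd e 0
            + (\<Sum>i=1..r. b' (2*i+1) *\<^sub>R
                 (crd e (2*i+1) x *\<^sub>R dcrd e (2*i+2) - crd e (2*i+2) x *\<^sub>R dcrd e (2*i+1)))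
            + q *\<^sub>R dcrd e n" (is "_ = ?R") for x
    proof (rule tr)
      have "L (P *v x + p) + l = (\<Sum>i=0..n. crd e i x *\<^sub>R L (f i)) + q *\<^sub>R f n"
        using Lp by (simp add: linear_add[OF linL] add.assoc P linear_sum[OF linL] linear_scale[OF linL])
      also have "(\<Sum>i=0..n. crd e i x *\<^sub>R L (f i)) = (\<Sum>i<3. crd e i x *\<^sub>R L (f i)) +
          (\<Sum>i=1..r. crd e (2*i+1) x *\<^sub>R L (f (2*i+1)) + crd e (2*i+2) x *\<^sub>R L (f (2*i+2)))"
        using sum_pairs[of 1 r n "\<lambda>i. crd e i x *\<^sub>R L (f i)"] L0 r by (simp add: eval_nat_numeral)
      also have "(\<Sum>i=1..r. crd e (2*i+1) x *\<^sub>R L (f (2*i+1)) + crd e (2*i+2) x *\<^sub>R L (f (2*i+2)))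
         = (\<Sum>i=1..r. P *v (?J *v (b' (2*i+1) *\<^sub>R
                 (crd e (2*i+1) x *\<^sub>R dcrd e (2*i+2) - crd e (2*i+2) x *\<^sub>R dcrd e (2*i+1)))))"
      proof (rule sum.cong[OF refl])
        fix i assume i: "i \<in> {1..r}"
        then have "2*i+1 \<le> n" "2*i+2 \<le> n" using r by auto
        then show "crd e (2*i+1) x *\<^sub>R L (f (2*i+1)) + crd e (2*i+2) x *\<^sub>R L (f (2*i+2)) =
          P *v (?J *v (b' (2*i+1) *\<^sub>R
                 (crd e (2*i+1) x *\<^sub>R dcrd e (2*i+2) - crd e (2*i+2) x *\<^sub>R dcrd e (2*i+1))))"
          unfolding Lb'[OF i] by (simp add: pj Pd algebra_simps)
      qed
      also have "(\<Sum>i<3. crd e i x *\<^sub>R L (f i)) = P *v (?J *v (crd e 0 x *\<^sub>R dcrd e 2 - crd e 2 x *\<^sub>R dcrd e 0))"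
        using r Lf by (simp add: pj Pd eval_nat_numeral)
      also have "q *\<^sub>R f n = P *v (?J *v (q *\<^sub>R dcrd e n))"
        using assms(1) by (simp add: pj Pd)
      finally show "\<eta> (P *v x + p) = ?J *v (P *v (?J *v ?R))" by (simp only: \<eta> pj)
    qed
    ultimately show ?thesis using \<Lambda> r by (intro exI[of _ \<Lambda>] exI[of _ c] exI[of _ r] exI[of _ b'] exI[of _ q] conjI disjI1) auto
  next
    case False
    then have K0: "K x = 0" for x by blast
    \<comment> \<open>Here \<open>\<xi>\<close> is constant, and \<open>k\<close> itself serves as
      the null eigenvector of \<open>L\<close>.\<close>
    have "k \<noteq> 0" using assms(5) by (auto simp: \<xi> K0)
    moreover have "L k = k" using lk K0 by simp
    ultimately obtain p f r b q where f: "lorentz_frame f n" and r: "2 * r + 1 \<le> n"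
      and k: "f 0 + f 1 = k" and Lp: "L p + l = q *\<^sub>R f n" and Lf: "L (f 0) = f 1" "L (f 1) = f 0"
      and Lb: "\<And>i. i < r \<Longrightarrow> L (f (2*i+2)) = b i *\<^sub>R f (2*i+3)"
        "\<And>i. i < r \<Longrightarrow> L (f (2*i+3)) = - b i *\<^sub>R f (2*i+2)"
      and L0: "\<And>i. i \<le> n \<Longrightarrow> 2*r+2 \<le> i \<Longrightarrow> L (f i) = 0"
      using boost_translation_frame[OF L _ _ DIM, of k l] by blast
    define b' where "b' j = b (j div 2 - 1)" for j
    have Lb': "L (f (2*i)) = b' (2*i) *\<^sub>R f (2*i+1)" "L (f (2*i+1)) = - b' (2*i) *\<^sub>R f (2*i)"
      if "i \<in> {1..r}" for i
    proof -
      define j where "j = i - 1"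
      have "2*i = 2*j+2" "2*i+1 = 2*j+3" "j < r" "b' (2*i) = b j"
        using that by (auto simp: j_def b'_def)
      then show "L (f (2*i)) = b' (2*i) *\<^sub>R f (2*i+1)" "L (f (2*i+1)) = - b' (2*i) *\<^sub>R f (2*i)"
        using Lb[of j] by (simp_all only:)
    qed
    obtain \<Lambda> c P where \<Lambda>: "\<Lambda> \<in> lorentz_group e"
      and Pd: "\<And>i. i \<le> n \<Longrightarrow> P *v (?J *v dcrd e i) = (if i = 0 then - f i else f i)"
      and P: "\<And>x. P *v x = (\<Sum>i=0..n. crd e i x *\<^sub>R f i)"
      and tr: "\<And>\<zeta> x R. \<zeta> (P *v x + p) = ?J *v (P *v (?J *v R)) \<Longrightarrow> transform_form \<Lambda> c \<zeta> x = R"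
      by (rule lorentz_frame_transformation[OF assms(2) f, of p]) (rule that)
    note pj = matrix_vector_right_distrib matrix_vector_mult_diff_distrib matrix_vector_mult_scaleR
      linear_sum[OF matrix_vector_mul_linear]
    have "transform_form \<Lambda> c \<xi> x = - dcrd e 0 + dcrd e 1" for x
    proof (rule tr)
      show "\<xi> (P *v x + p) = ?J *v (P *v (?J *v (- dcrd e 0 + dcrd e 1)))"
        using assms(1) by (simp add: \<xi> K0 pj Pd linear_neg[OF matrix_vector_mul_linear] flip: k)
    qed
    moreover have "transform_form \<Lambda> c \<eta> x = crd e 0 x *\<^sub>R dcrd e 1 - crd e 1 x *\<^sub>R dcrd e 0
            + (\<Sum>i=1..r. b' (2*i) *\<^sub>R
                 (crd e (2*i) x *\<^sub>R dcrd e (2*i+1) - crd e (2*i+1) x *\<^sub>R dcrd e (2*i)))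
            + q *\<^sub>R dcrd e n" (is "_ = ?R") for x
    proof (rule tr)
      have "L (P *v x + p) + l = (\<Sum>i=0..n. crd e i x *\<^sub>R L (f i)) + q *\<^sub>R f n"
        using Lp by (simp add: linear_add[OF linL] add.assoc P linear_sum[OF linL] linear_scale[OF linL])
      also have "(\<Sum>i=0..n. crd e i x *\<^sub>R L (f i)) = (\<Sum>i<2. crd e i x *\<^sub>R L (f i)) +
          (\<Sum>i=1..r. crd e (2*i) x *\<^sub>R L (f (2*i)) + crd e (2*i+1) x *\<^sub>R L (f (2*i+1)))"
        using sum_pairs[of 0 r n "\<lambda>i. crd e i x *\<^sub>R L (f i)"] L0 r by (simp add: eval_nat_numeral)
      also have "(\<Sum>i=1..r. crd e (2*i) x *\<^sub>R L (f (2*i)) + crd e (2*i+1) x *\<^sub>R L (f (2*i+1)))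
         = (\<Sum>i=1..r. P *v (?J *v (b' (2*i) *\<^sub>R
                 (crd e (2*i) x *\<^sub>R dcrd e (2*i+1) - crd e (2*i+1) x *\<^sub>R dcrd e (2*i)))))"
      proof (rule sum.cong[OF refl])
        fix i assume i: "i \<in> {1..r}"
        then have "2*i \<le> n" "2*i+1 \<le> n" "i \<noteq> 0" using r by auto
        then show "crd e (2*i) x *\<^sub>R L (f (2*i)) + crd e (2*i+1) x *\<^sub>R L (f (2*i+1)) =
          P *v (?J *v (b' (2*i) *\<^sub>R
                 (crd e (2*i) x *\<^sub>R dcrd e (2*i+1) - crd e (2*i+1) x *\<^sub>R dcrd e (2*i))))"
          unfolding Lb'[OF i] by (simp add: pj Pd algebra_simps)
      qed
      also have "(\<Sum>i<2. crd e i x *\<^sub>R L (f i)) = P *v (?J *v (crd e 0 x *\<^sub>R dcrd e 1 - crd e 1 x *\<^sub>R dcrd e 0))"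
        using r Lf by (simp add: pj Pd eval_nat_numeral)
      also have "q *\<^sub>R f n = P *v (?J *v (q *\<^sub>R dcrd e n))"
        using assms(1) by (simp add: pj Pd)
      finally show "\<eta> (P *v x + p) = ?J *v (P *v (?J *v ?R))" by (simp only: \<eta> pj)
    qed
    ultimately show ?thesis using \<Lambda> r by (intro exI[of _ \<Lambda>] exI[of _ c] exI[of _ r] exI[of _ b'] exI[of _ q] conjI disjI2) auto
  qed
qed

end
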